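(* For each positive integer $t$, \[\liminf_{n\to\infty}\frac{\mathrm{ex}(n,\{C_3,K_{2,2t+1}\})}{z(n,K_{2,2t+1})}\ge\frac{t+1}{\sqrt{t(t+2)}}.\]
   Context: $\mathrm{ex}(n,\mathcal{H})$ is the maximum number of edges in an $n$-vertex graph containing no member of $\mathcal{H}$ as a subgraph; $z(n,H)$ is the maximum number of edges in an $n$-vertex bipartite graph containing no copy of $H$. $C_3$ is the triangle and $K_{2,2t+1}$ the complete bipartite graph with parts of sizes $2$ and $2t+1$. *)

theory Defs
  imports Complex_Main "HOL-Library.Extended_Real"
begin

type_synonym 'a graph = "'a set \<times> 'a set set"

abbreviation verts :: "'a graph \<Rightarrow> 'a set" where "verts \<equiv> fst"
abbreviation edges :: "'a graph \<Rightarrow> 'a set set" where "edges \<equiv> snd"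

definition simple_graph :: "'a graph \<Rightarrow> bool" where
  "simple_graph G \<longleftrightarrow> finite (verts G) \<and> (\<forall>e\<in>edges G. e \<subseteq> verts G \<and> card e = 2)"

definition bipartite :: "'a graph \<Rightarrow> bool" where
  "bipartite G \<longleftrightarrow> (\<exists>X Y. X \<union> Y = verts G \<and> X \<inter> Y = {} \<and>
     (\<forall>e\<in>edges G. \<exists>x\<in>X. \<exists>y\<in>Y. e = {x, y}))"

text \<open>A not necessarily induced subgraph of \<open>G\<close> isomorphic to \<open>H\<close>.\<close>

definition contains_copy :: "'a graph \<Rightarrow> 'b graph \<Rightarrow> bool" where
  "contains_copy G H \<longleftrightarrow> (\<exists>f. inj_on f (verts H) \<and> f ` verts H \<subseteq> verts G \<and>
     (\<forall>e\<in>edges H. f ` e \<in> edges G))"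

definition triangle_graph :: "nat graph" where
  "triangle_graph = ({0, 1, 2}, {{0, 1}, {1, 2}, {0, 2}})"

definition complete_bipartite :: "nat \<Rightarrow> nat \<Rightarrow> nat graph" where
  "complete_bipartite r s = ({..<r + s}, {{i, j} | i j. i < r \<and> r \<le> j \<and> j < r + s})"

text \<open>Every finite graph is isomorphic to one whose vertices are natural numbers, so in both
  extremal numbers it suffices to let \<open>G\<close> range over such graphs.  The maxima are over finite
  sets; they are over nonempty sets whenever every forbidden graph has an edge.\<close>

definition ex_number :: "nat \<Rightarrow> 'b graph set \<Rightarrow> nat" where
  "ex_number n \<H> = Max {card (edges G) | G :: nat graph.
     simple_graph G \<and> card (verts G) = n \<and> (\<forall>H\<in>\<H>. \<not> contains_copy G H)}"

definition z_number :: "nat \<Rightarrow> 'b graph \<Rightarrow> nat" where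
  "z_number n H = Max {card (edges G) | G :: nat graph.
     simple_graph G \<and> bipartite G \<and> card (verts G) = n \<and> \<not> contains_copy G H}"

lemma card_edges_le:
  assumes "simple_graph G"
  shows "card (edges G) \<le> 2 ^ card (verts G)"
proof -
  have "edges G \<subseteq> Pow (verts G)" "finite (verts G)"
    using assms by (auto simp: simple_graph_def)
  then show ?thesis
    by (metis card_Pow card_mono finite_Pow_iff)
qed

lemma finite_ex_number_set:
  "finite {card (edges G) | G :: nat graph.
     simple_graph G \<and> card (verts G) = n \<and> (\<forall>H\<in>\<H>. \<not> contains_copy G H)}"
  by (rule finite_subset[of _ "{..2 ^ n}"]) (auto dest: card_edges_le)

lemma finite_z_number_set:
  "finite {card (edges G) | G :: nat graph.
     simple_graph G \<and> bipartite G \<and> card (verts G) = n \<and> \<not> contains_copy G H}"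
  by (rule finite_subset[of _ "{..2 ^ n}"]) (auto dest: card_edges_le)

lemma edgeless_admissible:
  fixes n :: nat
  assumes "edges H \<noteq> {}"
  shows "simple_graph ({..<n}, {})" "bipartite ({..<n}, {})" "\<not> contains_copy ({..<n}, {}) H"
  using assms by (auto simp: simple_graph_def bipartite_def contains_copy_def
    intro: exI[of _ "{}"])

end

theory Submission
  imports Defs "HOL-Complex_Analysis.Complex_Analysis" "HOL-Number_Theory.Number_Theory"
    "HOL-Real_Asymp.Real_Asymp"
begin

text \<open>
  Double counting pairs from either side of a bipartite graph bounds the denominator by
  \<open>(1/2 + o(1)) \<surd>t n\<^sup>3\<^sup>/\<^sup>2\<close>.  For the numerator, take \<open>t + 2\<close> copies of the affine plane over
  \<open>F\<^sub>p\<close> and join \<open>(x, y)\<close> in the \<open>i\<close>-th to \<open>(x', y')\<close> in the \<open>j\<close>-th copy if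
  \<open>y' - y = (x' - x)\<^sup>2 / u + 3 \<nu> u\<^sup>3\<close>, where \<open>u = j - i\<close> and \<open>\<nu>\<close> is a quadratic nonresidue.  Two
  points have at most two common neighbours in any third copy, and at most one if they lie in the
  same copy, so all codegrees are at most \<open>2 t\<close>; a triangle would make \<open>\<nu>\<close> a square.  The graph is
  \<open>(t + 1) p\<close>-regular on \<open>(t + 2) p\<^sup>2\<close> vertices.

  To reach every large \<open>n\<close> one needs primes in \<open>[x, (1 + \<epsilon>) x]\<close> for all large \<open>x\<close>.  By the
  nonvanishing of \<open>\<zeta>\<close> on \<open>Re s = 1\<close>, the function \<open>-\<zeta>'/\<zeta> - \<zeta>\<close> is holomorphic around \<open>Re s \<ge> 1\<close>.
  Integrating it against a Fejer kernel and applying the Riemann--Lebesgue lemma shows that \<open>\<Lambda>\<close> and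
  \<open>1\<close> have asymptotically the same smoothed averages on a logarithmic scale.  An interval
  \<open>[x, (1 + \<epsilon>) x]\<close> without primes would contradict this for a sufficiently concentrated kernel.
\<close>

section \<open>Common neighbours and the extremal numbers\<close>

text \<open>With \<open>r\<close> copies instead of \<open>t + 2\<close> the graph has
  \<open>r (r - 1) p^3 / 2\<close> edges on \<open>r p^2\<close> vertices, which is
  \<open>(r - 1) / (2 sqrt r)\<close> times \<open>n^(3/2)\<close>, and the codegree bounds are
  \<open>2 (r - 2)\<close> between copies and \<open>r - 1\<close> within a copy. So
  \<open>r = t + 2\<close> is the largest choice that keeps \<open>2 (r - 2) <= 2 t\<close>, and
  division by \<open>sqrt t / 2\<close> produces the constant of the theorem. The gain has a simple
  source: in a bipartite graph a pair of vertices on opposite sides has no common neighbour. The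
  edge equation is built on the identities
  \<open>a^2/u + b^2/v - (a+b)^2/(u+v) = (a v - b u)^2 / (u v (u+v))\<close> and
  \<open>(u+v)^3 - u^3 - v^3 = 3 u v (u+v)\<close>. The ratio of consecutive primes must tend to 1,
  since a merely bounded ratio would cost a constant factor. The Fejer kernel is suited to this: its
  Fourier transform has compact support, which confines the argument to a bounded piece of the line
  \<open>Re s = 1\<close>, and it is nonnegative, so that partial sums bound the whole from
  below.\<close>

definition common_nbrs :: "'a graph \<Rightarrow> 'a \<Rightarrow> 'a \<Rightarrow> 'a set" where
  "common_nbrs G x y = {v. {x, v} \<in> edges G \<and> {y, v} \<in> edges G}"

lemma simple_graph_edgeD:
  assumes "simple_graph G" "{x, y} \<in> edges G"
  shows "x \<noteq> y" "x \<in> verts G" "y \<in> verts G"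
  using assms by (auto simp: simple_graph_def card_insert_if split: if_splits)

lemma finite_common_nbrs: "simple_graph G \<Longrightarrow> finite (common_nbrs G x y)"
  by (rule finite_subset[of _ "verts G"])
    (auto simp: common_nbrs_def simple_graph_def)

lemma contains_copy_K2I:
  assumes G: "simple_graph G" and "x \<noteq> y" and s: "s \<le> card (common_nbrs G x y)" "s > 0"
  shows "contains_copy G (complete_bipartite 2 s)"
proof -
  obtain C where C: "C \<subseteq> common_nbrs G x y" "card C = s" "finite C"
    using s(1) obtain_subset_with_card_n by blast
  obtain h where h: "bij_betw h {..<s} C"
    using ex_bij_betw_nat_finite[OF C(3)] C(2) by (auto simp: lessThan_atLeast0)
  define f where "f i = (if i = 0 then x else if i = 1 then y else h (i - 2))" for i :: nat
  have hC: "h i \<in> common_nbrs G x y" if "i < s" for i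
    using h C(1) that by (auto simp: bij_betw_def)
  have hx: "h i \<noteq> x" "h i \<noteq> y" "h i \<in> verts G" "x \<in> verts G" "y \<in> verts G"
    "{x, h i} \<in> edges G" "{y, h i} \<in> edges G" if "i < s" for i
    using hC[OF that] simple_graph_edgeD[OF G]  by (auto simp: common_nbrs_def)
  have *: "i - 2 < s" if "i < 2 + s" "i \<noteq> 0" "i \<noteq> 1" for i :: nat
    using that s(2) by auto
  have inj: "inj_on f {..<2 + s}"
  proof (rule inj_onI)
    fix i j assume ij: "i \<in> {..<2 + s}" "j \<in> {..<2 + s}" "f i = f j"
    have hh: "f k = h (k - 2) \<and> f k \<noteq> x \<and> f k \<noteq> y" if "k \<in> {..<2 + s}" "k \<noteq> 0" "k \<noteq> 1" for k
      using hx(1,2)[OF *[of k]] that by (auto simp: f_def)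
    have f01: "f 0 = x" "f 1 = y" by (auto simp: f_def)
    show "i = j"
    proof (cases "i \<in> {0, 1} \<or> j \<in> {0, 1}")
      case True
      have "f k = x \<longleftrightarrow> k = 0" "f k = y \<longleftrightarrow> k = 1" if "k \<in> {..<2 + s}" for k
        using hh[OF that] f01 \<open>x \<noteq> y\<close> by metis+
      then show ?thesis using ij True f01 by (metis insertE singletonD)
    next
      case False
      then have "h (i - 2) = h (j - 2)" "i - 2 < s" "j - 2 < s"
        using hh[OF ij(1)] hh[OF ij(2)] ij by auto
      then have "i - 2 = j - 2" using h by (auto simp: bij_betw_def inj_on_def)
      then show ?thesis using False by auto
    qed
  qed
  show ?thesis
    unfolding contains_copy_def
  proof (intro exI[of _ f] conjI)
    show "inj_on f (verts (complete_bipartite 2 s))"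
      using inj by (simp add: complete_bipartite_def)
    show "f ` verts (complete_bipartite 2 s) \<subseteq> verts G"
      using hx(3-5)[OF *] hx(4,5)[OF s(2)] by (auto simp: complete_bipartite_def f_def)
    show "\<forall>e\<in>edges (complete_bipartite 2 s). f ` e \<in> edges G"
    proof
      fix e assume "e \<in> edges (complete_bipartite 2 s)"
      then obtain i j where e: "e = {i, j}" "i < 2" "2 \<le> j" "j < 2 + s"
        by (auto simp: complete_bipartite_def)
      have "j - 2 < s" using e by auto
      then show "f ` e \<in> edges G"
      proof -
        have "f j = h (j - 2)" using e by (auto simp: f_def)
        moreover have "f i = x \<or> f i = y" using e by (auto simp: f_def)
        ultimately show ?thesis
          unfolding e(1) image_insert image_empty using hx(6,7)[OF \<open>j - 2 < s\<close>] by presburger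
      qed
    qed
  qed
qed

lemma contains_copy_K2D:
  assumes G: "simple_graph G" and "contains_copy G (complete_bipartite 2 s)"
  obtains x y where "x \<in> verts G" "y \<in> verts G" "x \<noteq> y" "s \<le> card (common_nbrs G x y)"
proof -
  obtain f where f: "inj_on f {..<2 + s}" "f ` {..<2 + s} \<subseteq> verts G"
    "\<And>i j. i < 2 \<Longrightarrow> 2 \<le> j \<Longrightarrow> j < 2 + s \<Longrightarrow> f ` {i, j} \<in> edges G"
  proof -
    obtain f where f: "inj_on f (verts (complete_bipartite 2 s))"
      "f ` verts (complete_bipartite 2 s) \<subseteq> verts G"
      "\<And>e. e \<in> edges (complete_bipartite 2 s) \<Longrightarrow> f ` e \<in> edges G"
      using assms(2) unfolding contains_copy_def by blast
    have "{i, j} \<in> edges (complete_bipartite 2 s)" if "i < 2" "2 \<le> j" "j < 2 + s" for i j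
      using that by (auto simp: complete_bipartite_def)
    with f have "inj_on f {..<2 + s}" "f ` {..<2 + s} \<subseteq> verts G"
      "\<And>i j. i < 2 \<Longrightarrow> 2 \<le> j \<Longrightarrow> j < 2 + s \<Longrightarrow> f ` {i, j} \<in> edges G"
      unfolding complete_bipartite_def fst_conv by blast+
    then show ?thesis by (rule that)
  qed
  have "f ` {2..<2 + s} \<subseteq> common_nbrs G (f 0) (f 1)"
    using f(3)[of 0] f(3)[of 1] by (auto simp: common_nbrs_def)
  then have "card (f ` {2..<2 + s}) \<le> card (common_nbrs G (f 0) (f 1))"
    by (rule card_mono[OF finite_common_nbrs[OF G]])
  moreover have "card (f ` {2..<2 + s}) = s"
    by (subst card_image) (auto intro: inj_on_subset[OF f(1)])
  ultimately have "s \<le> card (common_nbrs G (f 0) (f 1))" by simp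
  moreover have "f 0 \<noteq> f 1" "f 0 \<in> verts G" "f 1 \<in> verts G"
    using f(1,2) by (auto simp: inj_on_def)
  ultimately show ?thesis using that by blast
qed

lemma contains_copy_triangleD:
  assumes "contains_copy G triangle_graph"
  obtains x y z where "{x, y} \<in> edges G" "{y, z} \<in> edges G" "{x, z} \<in> edges G"
  using assms unfolding contains_copy_def triangle_graph_def by auto

text \<open>Triples \<open>(x, x', y)\<close> with \<open>y\<close> adjacent to both are counted by
  apex, as the sum of \<open>(d y)^2\<close>, and by pairs: the diagonal pairs give
  \<open>m\<close>, the others at most \<open>s\<close> each. Cauchy-Schwarz over \<open>Y\<close>
  then compares \<open>m^2\<close> with the sum of squares. Charging \<open>s\<close> to the
  diagonal as well costs only a lower order.\<close>

lemma bipartite_pairs_bound: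
  fixes X :: "'a set" and Y :: "'b set" and R :: "'a \<Rightarrow> 'b \<Rightarrow> bool" and s :: nat
  assumes fin: "finite X" "finite Y"
    and co: "\<And>x x'. x \<in> X \<Longrightarrow> x' \<in> X \<Longrightarrow> x \<noteq> x' \<Longrightarrow> card {y\<in>Y. R x y \<and> R x' y} \<le> s"
    and m: "m = card {(x, y). x \<in> X \<and> y \<in> Y \<and> R x y}"
  shows "(real m)\<^sup>2 \<le> real m * card Y + s * (card X)\<^sup>2 * card Y"
proof -
  define d where "d y = card {x\<in>X. R x y}" for y
  have m1: "m = (\<Sum>y\<in>Y. d y)"
  proof -
    have "{(x, y). x \<in> X \<and> y \<in> Y \<and> R x y} = prod.swap ` (SIGMA y:Y. {x\<in>X. R x y})"
      by (auto simp: image_iff)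
    then show ?thesis
      unfolding m d_def using fin by (simp add: card_image inj_on_def)
  qed
  have "(\<Sum>y\<in>Y. (d y)\<^sup>2) = (\<Sum>y\<in>Y. \<Sum>x\<in>X. \<Sum>x'\<in>X. (if R x y \<and> R x' y then 1 else 0))"
  proof (rule sum.cong[OF refl])
    fix y
    have "d y = (\<Sum>x\<in>X. if R x y then 1 else 0)"
      unfolding d_def using fin by (simp add: sum.If_cases Int_def)
    then show "(d y)\<^sup>2 = (\<Sum>x\<in>X. \<Sum>x'\<in>X. (if R x y \<and> R x' y then 1 else 0))"
      by (simp add: power2_eq_square sum_product) (auto intro!: sum.cong)
  qed
  also have "\<dots> = (\<Sum>x\<in>X. \<Sum>x'\<in>X. \<Sum>y\<in>Y. (if R x y \<and> R x' y then 1 else 0))"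
    by (subst sum.swap, rule sum.cong[OF refl], rule sum.swap)
  also have "\<dots> = (\<Sum>x\<in>X. \<Sum>x'\<in>X. card {y\<in>Y. R x y \<and> R x' y})"
    using fin by (simp add: sum.If_cases Int_def)
  also have "\<dots> \<le> (\<Sum>x\<in>X. \<Sum>x'\<in>X. (if x = x' then card {y\<in>Y. R x y} else 0) + s)"
    by (intro sum_mono) (auto intro: co)
  also have "\<dots> = (\<Sum>x\<in>X. card {y\<in>Y. R x y}) + s * (card X)\<^sup>2"
    using fin by (simp add: sum.distrib power2_eq_square)
  also have "(\<Sum>x\<in>X. card {y\<in>Y. R x y}) = m"
  proof -
    have "{(x, y). x \<in> X \<and> y \<in> Y \<and> R x y} = (SIGMA x:X. {y\<in>Y. R x y})" by auto
    then show ?thesis unfolding m using fin by simp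
  qed
  finally have "(\<Sum>y\<in>Y. (d y)\<^sup>2) \<le> m + s * (card X)\<^sup>2" .
  then have sq: "(\<Sum>y\<in>Y. (real (d y))\<^sup>2) \<le> real m + s * (real (card X))\<^sup>2"
    by (metis (mono_tags, lifting) of_nat_add of_nat_le_iff of_nat_mult of_nat_power of_nat_sum sum.cong)
  have "(real m)\<^sup>2 = (\<Sum>y\<in>Y. 1 * real (d y))\<^sup>2" by (simp add: m1)
  also have "\<dots> \<le> (\<Sum>y\<in>Y. 1\<^sup>2) * (\<Sum>y\<in>Y. (real (d y))\<^sup>2)"
    by (rule Cauchy_Schwarz_ineq_sum)
  also have "\<dots> \<le> card Y * (real m + s * (real (card X))\<^sup>2)"
    using sq by (intro mult_mono) (auto simp: sum_nonneg)
  finally show ?thesis by (simp add: algebra_simps)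
qed

lemma bipartite_edges_bound:
  fixes G :: "'a graph" and t :: nat
  assumes G: "simple_graph G" "bipartite G"
    and n: "card (verts G) = n"
    and free: "\<not> contains_copy G (complete_bipartite 2 (2 * t + 1))"
  shows "real (card (edges G)) \<le> n + sqrt t / 2 * n * sqrt n"
proof -
  obtain X Y where XY: "X \<union> Y = verts G" "X \<inter> Y = {}"
     "\<forall>e\<in>edges G. \<exists>x\<in>X. \<exists>y\<in>Y. e = {x, y}"
    using G(2) unfolding bipartite_def by blast
  have fin: "finite X" "finite Y"
    using XY(1) G(1) by (metis finite_Un simple_graph_def)+
  define m where "m = card (edges G)"
  define a where "a = real (card X)"
  define b where "b = real (card Y)"
  have ab: "a + b = n" "a \<ge> 0" "b \<ge> 0"
    using card_Un_disjoint[OF fin XY(2)] n XY(1) by (auto simp: a_def b_def)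
  have co: "card {v\<in>V. {x, v} \<in> edges G \<and> {y, v} \<in> edges G} \<le> 2 * t" if "x \<noteq> y" for x y V
  proof (rule ccontr)
    assume "\<not> ?thesis"
    moreover have "card {v\<in>V. {x, v} \<in> edges G \<and> {y, v} \<in> edges G} \<le> card (common_nbrs G x y)"
      by (rule card_mono[OF finite_common_nbrs[OF G(1)]]) (auto simp: common_nbrs_def)
    ultimately show False
      using contains_copy_K2I[OF G(1) that, of "2 * t + 1"] free by simp
  qed
  have m1: "m = card {(x, y). x \<in> X \<and> y \<in> Y \<and> {x, y} \<in> edges G}"
  proof -
    define P where "P = {(x, y). x \<in> X \<and> y \<in> Y \<and> {x, y} \<in> edges G}"
    have "edges G = (\<lambda>(x, y). {x, y}) ` P"
      using XY(3) by (auto simp: P_def image_iff)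
    moreover have "inj_on (\<lambda>(x, y). {x, y}) P"
      using XY(2) by (auto simp: P_def inj_on_def doubleton_eq_iff)
    ultimately show ?thesis unfolding m_def P_def[symmetric] by (simp only: card_image)
  qed
  have m2: "m = card {(y, x). y \<in> Y \<and> x \<in> X \<and> {y, x} \<in> edges G}"
  proof -
    have "{(y, x). y \<in> Y \<and> x \<in> X \<and> {y, x} \<in> edges G}
        = prod.swap ` {(x, y). x \<in> X \<and> y \<in> Y \<and> {x, y} \<in> edges G}"
      by (force simp: insert_commute)
    then show ?thesis unfolding m1 by (simp add: card_image)
  qed
  have 1: "(real m)\<^sup>2 \<le> real m * b + 2 * t * a\<^sup>2 * b"
    using bipartite_pairs_bound[OF fin co m1] by (simp add: a_def b_def)
  have 2: "(real m)\<^sup>2 \<le> real m * a + 2 * t * b\<^sup>2 * a"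
    using bipartite_pairs_bound[OF fin(2,1) co m2] by (simp add: a_def b_def)
  \<comment> \<open>Pairs are to be counted on the smaller side, of size \<open>c\<close>: then
    \<open>c <= n / 2\<close> and \<open>c d <= n^2 / 4\<close>, so that
    \<open>c^2 d <= n^3 / 8\<close>. On the larger side \<open>c^2 d\<close> could exceed
    this.\<close>
  have *: "2 * t * c\<^sup>2 * d \<le> t * real n ^ 3 / 4" if "c + d = n" "c \<le> d" "c \<ge> 0" for c d :: real
  proof -
    have "c * (c * d) \<le> (n / 2) * (real n ^ 2 / 4)"
    proof (rule mult_mono)
      show "c * d \<le> real n ^ 2 / 4"
        using sum_squares_bound[of "c" "d"] that(1)[symmetric]
        by (simp add: power2_eq_square algebra_simps)
    qed (use that in auto)
    then have "real t * (2 * (c * (c * d))) \<le> real t * (2 * ((n / 2) * (real n ^ 2 / 4)))"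
      by (intro mult_left_mono) auto
    then show ?thesis by (simp add: power2_eq_square power3_eq_cube algebra_simps)
  qed
  have key: "(real m)\<^sup>2 \<le> real m * n + t * real n ^ 3 / 4"
  proof (cases "a \<le> b")
    case True
    have "real m * b \<le> real m * n" using ab by (intro mult_left_mono) auto
    then show ?thesis using 1 *[of a b] ab True by auto
  next
    case False
    have "real m * a \<le> real m * n" using ab by (intro mult_left_mono) auto
    then show ?thesis using 2 *[of b a] ab False by auto
  qed
  define r where "r = sqrt t / 2 * n * sqrt n"
  have r: "r \<ge> 0" "r\<^sup>2 = t * real n ^ 3 / 4"
    by (simp_all add: r_def power_mult_distrib power_divide power3_eq_cube power2_eq_square[of "real n"])
  show ?thesis
  proof (rule ccontr)
    assume "\<not> ?thesis"
    then have "real m > n + r" by (simp add: m_def r_def)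
    then have "(real m - n) * real m > r * r"
      using r(1) by (intro mult_strict_mono') auto
    then show False using key r(2) by (simp add: power2_eq_square algebra_simps)
  qed
qed

lemma z_number_le:
  "real (z_number n (complete_bipartite 2 (2 * t + 1))) \<le> n + sqrt t / 2 * n * sqrt n"
proof -
  let ?S = "{card (edges G) | G :: nat graph. simple_graph G \<and> bipartite G \<and> card (verts G) = n
     \<and> \<not> contains_copy G (complete_bipartite 2 (2 * t + 1))}"
  have "edges (complete_bipartite 2 (2 * t + 1)) \<noteq> {}"
    unfolding complete_bipartite_def by force
  from edgeless_admissible[OF this, of n] have "?S \<noteq> {}" by fastforce
  then have "z_number n (complete_bipartite 2 (2 * t + 1)) \<in> ?S"
    unfolding z_number_def by (intro Max_in finite_z_number_set)
  then show ?thesis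
    using bipartite_edges_bound by (smt (verit) mem_Collect_eq)
qed

text \<open>The quotient \<open>x / 0\<close> is \<open>0\<close> in HOL, so the comparison of
  ratios at the end requires a positive denominator. A single edge suffices: two distinct vertices
  then have no common neighbour.\<close>

lemma z_number_pos:
  assumes "n \<ge> 2" "s \<ge> 2"
  shows "z_number n (complete_bipartite 2 s) > 0"
proof -
  define G :: "nat graph" where "G = ({..<n}, {{0, 1}})"
  have G: "simple_graph G" using assms by (auto simp: G_def simple_graph_def)
  have "bipartite G"
    unfolding bipartite_def G_def using assms
    by (intro exI[of _ "{0}"] exI[of _ "{1..<n}"]) auto
  moreover have "\<not> contains_copy G (complete_bipartite 2 s)"
  proof
    assume "contains_copy G (complete_bipartite 2 s)"
    then obtain x y where "x \<noteq> y" "s \<le> card (common_nbrs G x y)"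
      using contains_copy_K2D[OF G] by metis
    moreover have "common_nbrs G x y = {}"
      using \<open>x \<noteq> y\<close> by (auto simp: common_nbrs_def G_def doubleton_eq_iff)
    ultimately show False using assms(2) by simp
  qed
  ultimately have "card (edges G) \<le> z_number n (complete_bipartite 2 s)"
    unfolding z_number_def using G
    by (intro Max_ge finite_z_number_set CollectI exI[of _ G]) (simp add: G_def)
  then show ?thesis by (simp add: G_def)
qed

text \<open>The construction lives on triples, whereas \<open>ex_number\<close> ranges over graphs
  on natural numbers with exactly \<open>n\<close> vertices. An injection into \<open>{..<n}\<close>
  transports it, and the vertices left over stay isolated, so every \<open>n >= card V\<close> is
  served by the same construction. The factor 2 comes from counting adjacent ordered pairs.\<close>

lemma ex_number_ge:
  fixes V :: "'a set" and adj :: "'a \<Rightarrow> 'a \<Rightarrow> bool"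
  assumes V: "finite V" "card V \<le> n" and s: "s > 0"
    and sym: "\<And>u v. adj u v \<Longrightarrow> adj v u" and irr: "\<And>u. \<not> adj u u"
    and tri: "\<And>u v w. \<lbrakk>u \<in> V; v \<in> V; w \<in> V; adj u v; adj v w\<rbrakk> \<Longrightarrow> \<not> adj u w"
    and codeg: "\<And>u v. \<lbrakk>u \<in> V; v \<in> V; u \<noteq> v\<rbrakk> \<Longrightarrow> card {w\<in>V. adj u w \<and> adj v w} < s"
    and deg: "\<And>u. u \<in> V \<Longrightarrow> d \<le> card {v\<in>V. adj u v}"
  shows "card V * d \<le> 2 * ex_number n {triangle_graph, complete_bipartite 2 s}"
proof -
  obtain g where g: "inj_on g V" "g ` V \<subseteq> {..<n}"
    using inj_on_iff_card_le[OF V(1), of "{..<n}"] V(2) by auto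
  define P where "P = {(u, v). u \<in> V \<and> v \<in> V \<and> adj u v}"
  define G :: "nat graph" where "G = ({..<n}, (\<lambda>(u, v). {g u, g v}) ` P)"
  have geq: "g u = g v \<longleftrightarrow> u = v" if "u \<in> V" "v \<in> V" for u v
    using g(1) that by (auto simp: inj_on_def)
  have G: "simple_graph G"
    using g(2) irr unfolding G_def simple_graph_def P_def by (auto simp: geq card_insert_if)
  have edge: "\<exists>u v. u \<in> V \<and> v \<in> V \<and> adj u v \<and> x = g u \<and> y = g v" if "{x, y} \<in> edges G" for x y
  proof -
    from that obtain u v where uv: "u \<in> V" "v \<in> V" "adj u v" "{x, y} = {g u, g v}"
      unfolding G_def P_def by auto
    then consider "x = g u" "y = g v" | "x = g v" "y = g u" by (auto simp: doubleton_eq_iff)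
    then show ?thesis using uv(1-3) sym[OF uv(3)] by cases blast+
  qed
  have adjI: "adj u v" if "{g u, g v} \<in> edges G" "u \<in> V" "v \<in> V" for u v
    using edge[OF that(1)] that geq by metis
  have "\<not> contains_copy G triangle_graph"
  proof
    assume "contains_copy G triangle_graph"
    then obtain x y z where xyz: "{x, y} \<in> edges G" "{y, z} \<in> edges G" "{x, z} \<in> edges G"
      by (rule contains_copy_triangleD)
    obtain u v w where uvw: "u \<in> V" "v \<in> V" "w \<in> V" "x = g u" "y = g v" "z = g w"
      using edge[OF xyz(1)] edge[OF xyz(2)] by metis
    then show False using xyz adjI tri by metis
  qed
  moreover have "\<not> contains_copy G (complete_bipartite 2 s)"
  proof
    assume "contains_copy G (complete_bipartite 2 s)"
    then obtain x y where xy: "x \<noteq> y" "s \<le> card (common_nbrs G x y)"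
      using contains_copy_K2D[OF G] by metis
    then have "common_nbrs G x y \<noteq> {}" using s by auto
    then show False
    proof -
      assume "common_nbrs G x y \<noteq> {}"
      then obtain z where z: "{x, z} \<in> edges G" "{y, z} \<in> edges G"
        by (auto simp: common_nbrs_def)
      obtain u v where uv: "u \<in> V" "v \<in> V" "x = g u" "y = g v"
        using edge[OF z(1)] edge[OF z(2)] by metis
      have "common_nbrs G x y \<subseteq> g ` {w\<in>V. adj u w \<and> adj v w}"
      proof
        fix c assume "c \<in> common_nbrs G x y"
        then have c: "{x, c} \<in> edges G" "{y, c} \<in> edges G" by (auto simp: common_nbrs_def)
        obtain w where "w \<in> V" "c = g w" using edge[OF c(1)] by metis
        then show "c \<in> g ` {w\<in>V. adj u w \<and> adj v w}"
          using c uv adjI by auto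
      qed
      then have "card (common_nbrs G x y) \<le> card {w\<in>V. adj u w \<and> adj v w}"
        using V(1) by (intro surj_card_le) auto
      then show False using codeg[OF uv(1,2)] xy uv by auto
    qed
  qed
  ultimately have "card (edges G) \<le> ex_number n {triangle_graph, complete_bipartite 2 s}"
    unfolding ex_number_def using G
    by (intro Max_ge finite_ex_number_set CollectI exI[of _ G]) (simp add: G_def)
  moreover have "card P \<le> 2 * card (edges G)"
  proof -
    have finP: "finite P" by (rule finite_subset[of _ "V \<times> V"]) (use V in \<open>auto simp: P_def\<close>)
    have "card P = (\<Sum>e\<in>edges G. card {q\<in>P. (\<lambda>(u, v). {g u, g v}) q = e})"
      using sum.image_gen[OF finP, of "\<lambda>_. 1 :: nat" "\<lambda>(u, v). {g u, g v}"]
      unfolding G_def snd_conv card_eq_sum .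
    also have "\<dots> \<le> (\<Sum>e\<in>edges G. 2)"
    proof (rule sum_mono)
      fix e assume "e \<in> edges G"
      then obtain u v where uv: "u \<in> V" "v \<in> V" "e = {g u, g v}"
        by (auto simp: G_def P_def)
      have "{q\<in>P. (\<lambda>(u, v). {g u, g v}) q = e} \<subseteq> {(u, v), (v, u)}"
        using uv geq by (auto simp: P_def doubleton_eq_iff)
      then have "card {q\<in>P. (\<lambda>(u, v). {g u, g v}) q = e} \<le> card {(u, v), (v, u)}"
        by (intro card_mono) auto
      also have "\<dots> \<le> 2" by (cases "u = v") auto
      finally show "card {q\<in>P. (\<lambda>(u, v). {g u, g v}) q = e} \<le> 2" .
    qed
    finally show ?thesis by simp
  qed
  moreover have "card V * d \<le> card P"
  proof -
    have "card P = (\<Sum>u\<in>V. card {v\<in>V. adj u v})"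
    proof -
      have "P = (SIGMA u:V. {v\<in>V. adj u v})" by (auto simp: P_def)
      then show ?thesis using V(1) by simp
    qed
    then show ?thesis using sum_mono[of V "\<lambda>_. d", OF deg] by simp
  qed
  ultimately show ?thesis by simp
qed

section \<open>The parabola graph\<close>

lemma eq_of_dvd_diff:
  fixes x y P :: int
  assumes "P dvd x - y" "x \<in> {0..<P}" "y \<in> {0..<P}"
  shows "x = y"
proof (rule ccontr)
  assume "x \<noteq> y"
  then have "\<bar>P\<bar> \<le> \<bar>x - y\<bar>" using assms(1) by (intro dvd_imp_le_int) auto
  then show False using assms by auto
qed

lemma card_linear_roots_mod_prime:
  fixes P a b :: int
  assumes P: "prime P" and a: "\<not> P dvd a"
  shows "card {z\<in>{0..<P}. P dvd a * z + b} \<le> 1"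
proof -
  have "z = z'" if "z \<in> {0..<P}" "P dvd a * z + b" "z' \<in> {0..<P}" "P dvd a * z' + b" for z z'
  proof -
    have "P dvd a * (z - z')" using dvd_diff[OF that(2,4)] by (simp add: algebra_simps)
    then have "P dvd z - z'" using P a prime_dvd_mult_iff by blast
    then show ?thesis using eq_of_dvd_diff that by blast
  qed
  then show ?thesis
    unfolding One_nat_def by (subst card_le_Suc0_iff_eq) (auto intro: finite_subset[of _ "{0..<P}"])
qed

text \<open>Given three roots, subtracting the congruence at another root \<open>v\<close> from that
  at \<open>x\<close> and cancelling \<open>x - v\<close> leaves a linear congruence in
  \<open>v\<close> with leading coefficient \<open>a\<close>; the two further roots contradict the
  uniqueness of its solution.\<close>

lemma card_quadratic_roots_mod_prime:
  fixes P a b c :: int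
  assumes P: "prime P" and a: "\<not> P dvd a"
  shows "card {z\<in>{0..<P}. P dvd a * z\<^sup>2 + b * z + c} \<le> 2"
proof (rule ccontr)
  define S where "S = {z\<in>{0..<P}. P dvd a * z\<^sup>2 + b * z + c}"
  assume "\<not> card {z\<in>{0..<P}. P dvd a * z\<^sup>2 + b * z + c} \<le> 2"
  then have "3 \<le> card S" by (simp add: S_def)
  then obtain T where T: "T \<subseteq> S" "card T = 3"
    using obtain_subset_with_card_n by metis
  then obtain x y z where xyz: "x \<in> S" "y \<in> S" "z \<in> S" "x \<noteq> y" "x \<noteq> z" "y \<noteq> z"
    unfolding card_3_iff by blast
  have *: "P dvd a * (x + v) + b" if "v \<in> S" "x \<noteq> v" for v
  proof -
    have "P dvd (a * x\<^sup>2 + b * x + c) - (a * v\<^sup>2 + b * v + c)"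
      using that(1) xyz(1) unfolding S_def by (blast intro: dvd_diff)
    also have "\<dots> = (x - v) * (a * (x + v) + b)"
      by (simp add: algebra_simps power2_eq_square)
    finally have "P dvd x - v \<or> P dvd a * (x + v) + b"
      using P prime_dvd_mult_iff by blast
    then show ?thesis
      using eq_of_dvd_diff[of P x v] that xyz(1) unfolding S_def by blast
  qed
  have "P dvd (a * (x + y) + b) - (a * (x + z) + b)"
    using xyz by (intro dvd_diff[OF *[of y] *[of z]])
  then have "P dvd a * (y - z)" by (simp add: algebra_simps)
  then have "P dvd y - z" using P a prime_dvd_mult_iff by blast
  then show False
    using eq_of_dvd_diff[of P y z] xyz unfolding S_def by blast
qed

text \<open>Squaring identifies \<open>1\<close> and \<open>P - 1\<close>, which differ because
  \<open>P > 2\<close>; a non-injective self-map of a finite set misses a value.\<close>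

lemma ex_quadratic_nonresidue:
  fixes P :: int
  assumes "prime P" "P > 2"
  obtains \<nu> where "\<And>z. \<not> P dvd z\<^sup>2 - \<nu>"
proof -
  let ?f = "\<lambda>z. z\<^sup>2 mod P"
  have "\<not> inj_on ?f {0..<P}"
  proof
    assume "inj_on ?f {0..<P}"
    moreover have "?f 1 = ?f (P - 1)"
      by (simp add: power2_eq_square algebra_simps mod_eq_dvd_iff)
    ultimately have "1 = P - 1"
      by (rule inj_onD) (use assms(2) in auto)
    then show False using assms(2) by simp
  qed
  moreover have "?f ` {0..<P} \<subseteq> {0..<P}" using assms by auto
  ultimately have "?f ` {0..<P} \<noteq> {0..<P}"
    using eq_card_imp_inj_on[of "{0..<P}" ?f] by auto
  then obtain \<nu> where \<nu>: "\<nu> \<in> {0..<P}" "\<nu> \<notin> ?f ` {0..<P}"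
    using \<open>?f ` {0..<P} \<subseteq> {0..<P}\<close> by blast
  have "\<not> P dvd z\<^sup>2 - \<nu>" for z
  proof
    assume "P dvd z\<^sup>2 - \<nu>"
    then have "z\<^sup>2 mod P = \<nu>" using \<nu>(1) by (metis atLeastLessThan_iff mod_eq_dvd_iff mod_pos_pos_trivial)
    then have "?f (z mod P) = \<nu>" by (simp add: power_mod)
    then show False using \<nu>(2) assms by (metis atLeastLessThan_iff image_eqI pos_mod_bound pos_mod_sign prime_gt_0_int)
  qed
  then show ?thesis using that by blast
qed

text \<open>With \<open>u = j - i\<close>, part \<open>i\<close> is joined to part \<open>j\<close> by translates of the parabola
  \<open>s \<mapsto> s\<^sup>2 / u + \<mu> u\<^sup>3\<close>; the definition clears the denominator.\<close>

fun parabola_adj :: "int \<Rightarrow> int \<Rightarrow> nat \<times> int \<times> int \<Rightarrow> nat \<times> int \<times> int \<Rightarrow> bool" where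
  "parabola_adj P \<mu> (i, x, y) (j, x', y') \<longleftrightarrow> i \<noteq> j \<and>
     P dvd (y' - y) * (int j - int i) - (x' - x)\<^sup>2 - \<mu> * (int j - int i) ^ 4"

text \<open>Both \<open>s^2 / u\<close> and \<open>u^3\<close> are odd in \<open>u\<close>, so
  reversing an edge negates both sides of its equation. A constant term even in \<open>u\<close>
  would break the symmetry.\<close>

lemma parabola_adj_sym: "parabola_adj P \<mu> u v \<Longrightarrow> parabola_adj P \<mu> v u"
proof (cases u; cases v)
  fix i x y j x' y' assume *: "parabola_adj P \<mu> u v" and uv: "u = (i, x, y)" "v = (j, x', y')"
  have "(y' - y) * (int j - int i) - (x' - x)\<^sup>2 - \<mu> * (int j - int i) ^ 4
      = (y - y') * (int i - int j) - (x - x')\<^sup>2 - \<mu> * (int i - int j) ^ 4"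
    using power2_commute[of x x'] power_even_eq[of "int i - int j" 2] power_even_eq[of "int j - int i" 2]
      power2_commute[of "int i" "int j"] by (simp add: algebra_simps)
  then show ?thesis using * uv by auto
qed

lemma parabola_adj_triangle_free:
  fixes P \<nu> :: int and r :: nat
  assumes P: "prime P" "P > 3" "P \<ge> int r" and \<nu>: "\<And>z. \<not> P dvd z\<^sup>2 - \<nu>"
    and "i < r" "j < r" "k < r"
    and uv: "parabola_adj P (3 * \<nu>) (i, x1, y1) (j, x2, y2)"
    and vw: "parabola_adj P (3 * \<nu>) (j, x2, y2) (k, x3, y3)"
  shows "\<not> parabola_adj P (3 * \<nu>) (i, x1, y1) (k, x3, y3)"
proof
  assume uw: "parabola_adj P (3 * \<nu>) (i, x1, y1) (k, x3, y3)"
  define a where "a = x2 - x1"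
  define b where "b = x3 - x2"
  define u where "u = int j - int i"
  define v where "v = int k - int j"
  have nd: "\<not> P dvd d" if "d \<noteq> 0" "\<bar>d\<bar> < P" for d
    using that dvd_imp_le_int[of d P] P(1) by auto
  have "i \<noteq> j" "j \<noteq> k" "i \<noteq> k" using uv vw uw by simp_all
  then have "\<not> P dvd u" "\<not> P dvd v" "\<not> P dvd (u + v)"
    using P(3) \<open>i < r\<close> \<open>j < r\<close> \<open>k < r\<close> unfolding u_def v_def by (simp_all add: nd)
  moreover have "\<not> P dvd 3" using P by (intro nd) auto
  ultimately have w: "\<not> P dvd 3 * (u * v * (u + v))"
    using P(1) by (simp add: prime_dvd_mult_iff)
  let ?w = "3 * (u * v * (u + v))"
  have uv': "P dvd (y2 - y1) * u - a\<^sup>2 - 3 * \<nu> * u ^ 4"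
    and vw': "P dvd (y3 - y2) * v - b\<^sup>2 - 3 * \<nu> * v ^ 4"
    and uw': "P dvd (y3 - y1) * (u + v) - (a + b)\<^sup>2 - 3 * \<nu> * (u + v) ^ 4"
    using uv vw uw by (simp_all add: a_def b_def u_def v_def)
  \<comment> \<open>Eliminating the second coordinates leaves a quadratic form that degenerates to a square,
    because the leading coefficients are \<open>1 / u\<close>, \<open>1 / v\<close> and \<open>1 / (u + v)\<close>; the cubic
    constants turn it into a nonresidue equation.\<close>
  have "P dvd v * (u + v) * ((y2 - y1) * u - a\<^sup>2 - 3 * \<nu> * u ^ 4)
      + u * (u + v) * ((y3 - y2) * v - b\<^sup>2 - 3 * \<nu> * v ^ 4)
      - u * v * ((y3 - y1) * (u + v) - (a + b)\<^sup>2 - 3 * \<nu> * (u + v) ^ 4)"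
    by (rule dvd_diff[OF dvd_add[OF dvd_mult[OF uv'] dvd_mult[OF vw']] dvd_mult[OF uw']])
  \<comment> \<open>The second coordinates drop out because their differences add up. The quartic
    terms amount to \<open>3 \<nu> u v (u + v)\<close> times \<open>(u + v)^3 - u^3 - v^3\<close>,
    that is \<open>\<nu> ?w^2\<close>; this is the origin of the factor 3 in
    \<open>3 * \<nu>\<close>.\<close>
  also have "\<dots> = - ((a * v - b * u)\<^sup>2 - \<nu> * ?w\<^sup>2)"
    by (simp add: algebra_simps power2_eq_square power4_eq_xxxx)
  finally have D: "P dvd (a * v - b * u)\<^sup>2 - \<nu> * ?w\<^sup>2" by (simp only: dvd_minus_iff)
  have "coprime ?w P" using w P(1) by (meson coprime_commute prime_imp_coprime)
  then obtain c where c: "[?w * c = 1] (mod P)"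
    using cong_solve_coprime_int by blast
  have "P dvd c\<^sup>2 * ((a * v - b * u)\<^sup>2 - \<nu> * ?w\<^sup>2) + \<nu> * ((?w * c)\<^sup>2 - 1)"
  proof (intro dvd_add dvd_mult)
    show "P dvd (?w * c)\<^sup>2 - 1"
      using cong_pow[OF c, of 2] by (simp add: cong_iff_dvd_diff)
  qed (use D in simp)
  also have "\<dots> = (c * (a * v - b * u))\<^sup>2 - \<nu>"
    by (simp add: algebra_simps power2_eq_square)
  finally show False using \<nu> by blast
qed

text \<open>Common neighbours in copy \<open>k\<close> are determined by their first coordinate
  \<open>z\<close>. Eliminating the second coordinate leaves a congruence for \<open>z\<close> whose
  leading coefficient is \<open>j - i\<close>. For points in distinct copies it is quadratic, and
  \<open>t\<close> copies with at most two roots each remain; for points in the same copy it is at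
  most linear, and \<open>t + 1\<close> copies remain, where \<open>t + 1 <= 2 * t\<close> because
  \<open>t >= 1\<close>.\<close>

lemma parabola_adj_codegree:
  fixes P \<mu> :: int and t :: nat
  assumes P: "prime P" "P > 2" "P \<ge> int t + 2" and t: "t \<ge> 1"
    and V: "V = {..<t + 2} \<times> {0..<P} \<times> {0..<P}"
    and v: "v \<in> V" "v' \<in> V" "v \<noteq> v'"
  shows "card {w\<in>V. parabola_adj P \<mu> v w \<and> parabola_adj P \<mu> v' w} \<le> 2 * t"
proof -
  obtain i x y where v1: "v = (i, x, y)" "i < t + 2" "x \<in> {0..<P}" "y \<in> {0..<P}"
    using v V by (cases v) auto
  obtain j x' y' where v2: "v' = (j, x', y')" "j < t + 2" "x' \<in> {0..<P}" "y' \<in> {0..<P}"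
    using v V by (cases v') auto
  have nd: "\<not> P dvd d" if "d \<noteq> 0" "\<bar>d\<bar> < P" for d
    using that dvd_imp_le_int[of d P] P(1) by auto
  have nd': "\<not> P dvd int k - int l" if "k \<noteq> l" "k < t + 2" "l < t + 2" for k l :: nat
    using that P by (intro nd) auto
  define N where "N k = {(z, w) \<in> {0..<P} \<times> {0..<P}.
     parabola_adj P \<mu> v (k, z, w) \<and> parabola_adj P \<mu> v' (k, z, w)}" for k
  define K where "K = {..<t + 2} - {i, j}"
  have finN: "finite (N k)" for k unfolding N_def by (rule finite_subset[of _ "{0..<P} \<times> {0..<P}"]) auto
  have inj: "inj_on fst (N k)" if k: "k < t + 2" for k
  proof (rule inj_onI)
    fix q q' assume q: "q \<in> N k" "q' \<in> N k" "fst q = fst q'"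
    obtain z w w' where zw: "q = (z, w)" "q' = (z, w')" using q(3) by (cases q; cases q') auto
    have ki: "k \<noteq> i" using q(1) by (auto simp: N_def v1)
    have "P dvd ((w - y) * (int k - int i) - (z - x)\<^sup>2 - \<mu> * (int k - int i) ^ 4)
        - ((w' - y) * (int k - int i) - (z - x)\<^sup>2 - \<mu> * (int k - int i) ^ 4)"
      using q(1,2) by (intro dvd_diff[of P "_ - _ - _" "_ - _ - _"]) (simp_all add: N_def v1 zw)
    also have "\<dots> = (w - w') * (int k - int i)" by (simp add: algebra_simps)
    finally have "P dvd w - w'" using nd'[OF ki k v1(2)] P(1) prime_dvd_mult_iff by blast
    then have "w = w'" using eq_of_dvd_diff q(1,2) by (auto simp: N_def zw)
    then show "q = q'" by (simp add: zw)
  qed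
  have "{w\<in>V. parabola_adj P \<mu> v w \<and> parabola_adj P \<mu> v' w} \<subseteq> (SIGMA k:K. N k)"
    unfolding V K_def N_def v1 v2 by auto
  then have "card {w\<in>V. parabola_adj P \<mu> v w \<and> parabola_adj P \<mu> v' w} \<le> card (SIGMA k:K. N k)"
    using finN by (intro card_mono finite_SigmaI) (auto simp: K_def)
  also have "\<dots> = (\<Sum>k\<in>K. card (N k))" using finN by (simp add: K_def)
  also have "\<dots> \<le> 2 * t"
  proof (cases "i = j")
    case False
    have "card (N k) \<le> 2" if "k \<in> K" for k
    proof -
      have k: "k \<noteq> i" "k \<noteq> j" "k < t + 2" using that by (auto simp: K_def)
      define u where "u = int k - int i"
      define u' where "u' = int k - int j"
      define c where "c = (y' - y) * u * u' - u' * x\<^sup>2 + u * x'\<^sup>2 - \<mu> * u' * u ^ 4 + \<mu> * u * u' ^ 4"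
      have "fst ` N k \<subseteq> {z\<in>{0..<P}. P dvd (u - u') * z\<^sup>2 + (2 * u' * x - 2 * u * x') * z + c}"
      proof (clarsimp simp: N_def v1 v2 simp flip: u_def u'_def)
        fix z w
        assume "P dvd (w - y) * u - (z - x)\<^sup>2 - \<mu> * u ^ 4" "P dvd (w - y') * u' - (z - x')\<^sup>2 - \<mu> * u' ^ 4"
        then have "P dvd u' * ((w - y) * u - (z - x)\<^sup>2 - \<mu> * u ^ 4) - u * ((w - y') * u' - (z - x')\<^sup>2 - \<mu> * u' ^ 4)"
          by (rule dvd_diff[OF dvd_mult dvd_mult])
        also have "\<dots> = (u - u') * z\<^sup>2 + (2 * u' * x - 2 * u * x') * z + c"
          unfolding c_def by (simp add: algebra_simps power2_eq_square)
        finally show "P dvd (u - u') * z\<^sup>2 + (2 * u' * x - 2 * u * x') * z + c" .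
      qed
      then have "card (fst ` N k) \<le> card {z\<in>{0..<P}. P dvd (u - u') * z\<^sup>2 + (2 * u' * x - 2 * u * x') * z + c}"
        by (rule card_mono[rotated]) (auto intro: finite_subset[of _ "{0..<P}"])
      also have "\<dots> \<le> 2"
        using nd'[of j i] False v1 v2 by (intro card_quadratic_roots_mod_prime P) (auto simp: u_def u'_def)
      finally show ?thesis by (simp only: card_image[OF inj[OF k(3)]])
    qed
    then have "(\<Sum>k\<in>K. card (N k)) \<le> (\<Sum>k\<in>K. 2)" by (rule sum_mono)
    moreover have "card K = t"
      using False v1 v2 by (simp add: K_def card_Diff_subset)
    ultimately show ?thesis by simp
  next
    case True
    have "card (N k) \<le> 1" if "k \<in> K" for k
    proof -
      have k: "k \<noteq> i" "k < t + 2" using that by (auto simp: K_def)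
      define u where "u = int k - int i"
      have D: "P dvd 2 * (x - x') * z + ((y' - y) * u + x'\<^sup>2 - x\<^sup>2)" if "(z, w) \<in> N k" for z w
      proof -
        have "P dvd ((w - y) * u - (z - x)\<^sup>2 - \<mu> * u ^ 4) - ((w - y') * u - (z - x')\<^sup>2 - \<mu> * u ^ 4)"
          using that by (intro dvd_diff[of P "_ - _ - _" "_ - _ - _"]) (simp_all add: N_def v1 v2 u_def True)
        also have "\<dots> = 2 * (x - x') * z + ((y' - y) * u + x'\<^sup>2 - x\<^sup>2)"
          by (simp add: algebra_simps power2_eq_square)
        finally show ?thesis .
      qed
      show ?thesis
      proof (cases "x = x'")
        case False
        have "\<not> P dvd 2" using P by (intro nd) auto
        moreover have "\<not> P dvd x - x'" using eq_of_dvd_diff[of P x x'] False v1 v2 by blast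
        ultimately have A: "\<not> P dvd 2 * (x - x')" using P(1) prime_dvd_mult_iff by blast
        have "fst ` N k \<subseteq> {z\<in>{0..<P}. P dvd 2 * (x - x') * z + ((y' - y) * u + x'\<^sup>2 - x\<^sup>2)}"
          using D by (auto simp: N_def)
        then have "card (fst ` N k) \<le> card {z\<in>{0..<P}. P dvd 2 * (x - x') * z + ((y' - y) * u + x'\<^sup>2 - x\<^sup>2)}"
          by (rule card_mono[rotated]) (auto intro: finite_subset[of _ "{0..<P}"])
        also have "\<dots> \<le> 1" by (rule card_linear_roots_mod_prime[OF P(1) A])
        finally show ?thesis by (simp only: card_image[OF inj[OF k(2)]])
      next
        case True
        \<comment> \<open>With equal first coordinates the linear congruence reduces to a constant,
          which is nonzero modulo \<open>P\<close> because the points differ in the second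
          coordinate.\<close>
        have "N k = {}"
        proof (rule ccontr)
          assume "N k \<noteq> {}"
          then obtain z w where "(z, w) \<in> N k" by auto
          from D[OF this] True have "P dvd (y' - y) * u" by simp
          moreover have "\<not> P dvd u" using nd'[OF k(1,2) v1(2)] by (simp add: u_def)
          ultimately have "P dvd y' - y" using P(1) prime_dvd_mult_iff by blast
          then have "y' = y" using eq_of_dvd_diff v1 v2 by blast
          then show False using v(3) v1 v2 True \<open>i = j\<close> by simp
        qed
        then show ?thesis by simp
      qed
    qed
    then have "(\<Sum>k\<in>K. card (N k)) \<le> (\<Sum>k\<in>K. 1)" by (rule sum_mono)
    moreover have "card K = t + 1"
      using True v1 v2 by (simp add: K_def card_Diff_subset)
    ultimately show ?thesis using t by simp
  qed
  finally show ?thesis .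
qed

lemma parabola_adj_degree:
  fixes P \<mu> :: int and t :: nat
  assumes P: "prime P" "P \<ge> int t + 2"
    and V: "V = {..<t + 2} \<times> {0..<P} \<times> {0..<P}"
    and v: "v \<in> V"
  shows "(t + 1) * nat P \<le> card {w\<in>V. parabola_adj P \<mu> v w}"
proof -
  obtain i x y where v1: "v = (i, x, y)" "i < t + 2" "x \<in> {0..<P}" "y \<in> {0..<P}"
    using v V by (cases v) auto
  have P0: "P > 0" using P(1) by (rule prime_gt_0_int)
  have "\<exists>w. w \<in> {0..<P} \<and> parabola_adj P \<mu> v (k, z, w)" if k: "k < t + 2" "k \<noteq> i" for k z
  proof -
    define u where "u = int k - int i"
    have "\<not> P dvd u"
      using k v1(2) P dvd_imp_le_int[of u P] by (auto simp: u_def)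
    then have "coprime u P" using P(1) by (meson coprime_commute prime_imp_coprime)
    then obtain c where c: "[u * c = 1] (mod P)"
      using cong_solve_coprime_int by blast
    let ?g = "(z - x)\<^sup>2 + \<mu> * u ^ 4"
    define w where "w = (y + c * ?g) mod P"
    have "[w = y + c * ?g] (mod P)" by (simp add: w_def cong_def)
    then have "P dvd u * (w - (y + c * ?g)) + (u * c - 1) * ?g"
      using c by (intro dvd_add dvd_mult dvd_mult2) (simp_all add: cong_iff_dvd_diff)
    also have "\<dots> = (w - y) * u - (z - x)\<^sup>2 - \<mu> * u ^ 4" by (simp add: algebra_simps)
    finally have "parabola_adj P \<mu> v (k, z, w)" using k by (simp add: v1 u_def)
    moreover have "w \<in> {0..<P}" using P0 by (simp add: w_def)
    ultimately show ?thesis by blast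
  qed
  then obtain h where h: "\<And>k z. k < t + 2 \<Longrightarrow> k \<noteq> i \<Longrightarrow>
      h k z \<in> {0..<P} \<and> parabola_adj P \<mu> v (k, z, h k z)"
    by metis
  let ?D = "({..<t + 2} - {i}) \<times> {0..<P}"
  have "card ?D \<le> card {w\<in>V. parabola_adj P \<mu> v w}"
  proof (rule card_inj_on_le)
    show "inj_on (\<lambda>(k, z). (k, z, h k z)) ?D" by (auto simp: inj_on_def)
    show "(\<lambda>(k, z). (k, z, h k z)) ` ?D \<subseteq> {w\<in>V. parabola_adj P \<mu> v w}"
      using h by (auto simp: V)
    show "finite {w\<in>V. parabola_adj P \<mu> v w}" by (simp add: V)
  qed
  also have "card ?D = (t + 1) * nat P" using v1(2) by (simp add: card_cartesian_product)
  finally show ?thesis by simp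
qed

lemma ex_number_prime_ge:
  fixes t p n :: nat
  assumes p: "prime p" "p > t + 2" "t \<ge> 1" "(t + 2) * p\<^sup>2 \<le> n"
  shows "(t + 2) * (t + 1) * p ^ 3 \<le> 2 * ex_number n {triangle_graph, complete_bipartite 2 (2 * t + 1)}"
proof -
  define P where "P = int p"
  have P: "prime P" "P > 3" "P \<ge> int (t + 2)" using p by (auto simp: P_def)
  obtain \<nu> where \<nu>: "\<And>z. \<not> P dvd z\<^sup>2 - \<nu>"
    using ex_quadratic_nonresidue[of P] P by auto
  define V where "V = {..<t + 2} \<times> {0..<P} \<times> {0..<P}"
  have cV: "card V = (t + 2) * p\<^sup>2"
    by (simp add: V_def P_def card_cartesian_product power2_eq_square)
  have "card V * ((t + 1) * nat P) \<le> 2 * ex_number n {triangle_graph, complete_bipartite 2 (2 * t + 1)}"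
  proof (rule ex_number_ge[where adj = "parabola_adj P (3 * \<nu>)"])
    show "finite V" by (simp add: V_def)
    show "card V \<le> n" using p by (simp add: cV)
    show "\<not> parabola_adj P (3 * \<nu>) u u" for u by (cases u) simp
    show "\<not> parabola_adj P (3 * \<nu>) u w" if "u \<in> V" "v \<in> V" "w \<in> V"
      "parabola_adj P (3 * \<nu>) u v" "parabola_adj P (3 * \<nu>) v w" for u v w
      using parabola_adj_triangle_free[OF P \<nu>] that unfolding V_def by (cases u; cases v; cases w) blast
    show "card {w \<in> V. parabola_adj P (3 * \<nu>) u w \<and> parabola_adj P (3 * \<nu>) v w} < 2 * t + 1"
      if "u \<in> V" "v \<in> V" "u \<noteq> v" for u v
      using parabola_adj_codegree[OF P(1) _ _ p(3) V_def that, of "3 * \<nu>"] P by simp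
    show "(t + 1) * nat P \<le> card {v \<in> V. parabola_adj P (3 * \<nu>) u v}" if "u \<in> V" for u
      using parabola_adj_degree[OF P(1) _ V_def that] P by simp
  qed (auto intro: parabola_adj_sym)
  then show ?thesis by (simp add: cV P_def power2_eq_square power3_eq_cube algebra_simps)
qed

section \<open>Dirichlet series\<close>

text \<open>The term of index \<open>0\<close> vanishes, since \<open>0 powr s = 0\<close>; also \<open>ln 0 = 0\<close>.\<close>

definition dirichlet_series :: "(nat \<Rightarrow> real) \<Rightarrow> complex \<Rightarrow> complex" where
  "dirichlet_series a s = (\<Sum>n. of_real (a n) * of_nat n powr (-s))"

lemma norm_of_nat_powr [simp]: "norm (of_nat n powr s :: complex) = real n powr Re s"
  by (subst norm_powr_real_powr) auto

text \<open>A common majorant for the coefficients \<open>1\<close> and \<open>mangoldt n\<close>,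
  so that \<open>\<zeta>\<close> and \<open>-\<zeta>'/\<zeta>\<close> can be treated by the same
  lemmas. The logarithm is absorbed by \<open>n powr \<epsilon>\<close>, with
  \<open>\<epsilon>\<close> half of the surplus \<open>\<sigma> - 1\<close>.\<close>

lemma summable_dirichlet_majorant:
  assumes "\<sigma> > 1"
  shows "summable (\<lambda>n. (1 + \<bar>ln (real n)\<bar>) * real n powr (-\<sigma>))"
proof (rule summable_comparison_test'[where N = 1])
  define \<epsilon> where "\<epsilon> = (\<sigma> - 1) / 2"
  have e: "\<epsilon> > 0" using assms by (simp add: \<epsilon>_def)
  have "\<epsilon> - \<sigma> < -1" using assms by (simp add: \<epsilon>_def field_simps)
  then show "summable (\<lambda>n. (1 + 1 / \<epsilon>) * real n powr (\<epsilon> - \<sigma>))"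
    by (intro summable_mult) (simp add: summable_real_powr_iff)
  show "norm ((1 + \<bar>ln (real n)\<bar>) * real n powr (-\<sigma>)) \<le> (1 + 1 / \<epsilon>) * real n powr (\<epsilon> - \<sigma>)"
    if "n \<ge> 1" for n
  proof -
    have "1 \<le> real n powr \<epsilon>" "ln (real n) \<le> real n powr \<epsilon> / \<epsilon>"
      using that e ln_powr_bound[of "real n" \<epsilon>] by (auto intro: ge_one_powr_ge_zero)
    then have "1 + \<bar>ln (real n)\<bar> \<le> (1 + 1 / \<epsilon>) * real n powr \<epsilon>"
      using that by (simp add: algebra_simps)
    then have "(1 + \<bar>ln (real n)\<bar>) * real n powr (-\<sigma>) \<le> (1 + 1 / \<epsilon>) * real n powr \<epsilon> * real n powr (-\<sigma>)"
      by (intro mult_right_mono) auto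
    then show ?thesis by (simp add: powr_add[symmetric] mult.assoc abs_mult)
  qed
qed

context
  fixes a :: "nat \<Rightarrow> real"
  assumes a: "\<And>n. \<bar>a n\<bar> \<le> 1 + \<bar>ln (real n)\<bar>"
begin

lemma dirichlet_term_le:
  assumes "\<sigma> \<le> Re s"
  shows "norm (of_real (a n) * of_nat n powr (-s) :: complex) \<le> (1 + \<bar>ln (real n)\<bar>) * real n powr (-\<sigma>)"
proof (cases "n = 0")
  case False
  then show ?thesis using a[of n] assms by (auto simp: norm_mult intro!: mult_mono powr_mono)
qed auto

lemma summable_norm_dirichlet:
  assumes "Re s > 1"
  shows "summable (\<lambda>n. norm (of_real (a n) * of_nat n powr (-s) :: complex))"
  by (rule summable_comparison_test'[OF summable_dirichlet_majorant[OF assms], where N = 0])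
     (use dirichlet_term_le[of "Re s" s] in simp)

lemma dirichlet_series_sums:
  assumes "Re s > 1"
  shows "(\<lambda>n. of_real (a n) * of_nat n powr (-s)) sums dirichlet_series a s"
  unfolding dirichlet_series_def
  by (rule summable_sums[OF summable_norm_cancel[OF summable_norm_dirichlet[OF assms]]])

text \<open>On the ball of radius \<open>(Re x - 1) / 2\<close> about \<open>x\<close> all real
  parts stay above \<open>(1 + Re x) / 2 > 1\<close>, so one summable majorant serves the whole
  ball. The derivative comes with its series, to be identified later by uniqueness of sums.\<close>

lemma dirichlet_series_derivative:
  assumes "Re s > 1"
  obtains D where "(\<lambda>n. - of_real (a n * ln (real n)) * of_nat n powr (-s)) sums D"
    "(dirichlet_series a has_field_derivative D) (at s)"
proof -
  let ?S = "{s. Re s > 1}"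
  have "\<exists>g g'. \<forall>x \<in> ?S. ((\<lambda>n. of_real (a n) * of_nat n powr (-x)) sums g x) \<and>
     ((\<lambda>n. - of_real (a n * ln (real n)) * of_nat n powr (-x)) sums g' x) \<and> (g has_field_derivative g' x) (at x)"
  proof (rule series_and_derivative_comparison_local)
    show "open ?S" by (rule open_halfspace_Re_gt)
    show "((\<lambda>x. of_real (a n) * of_nat n powr (-x)) has_field_derivative
         - of_real (a n * ln (real n)) * of_nat n powr (-x)) (at x)" for n and x :: complex
    proof (cases "n = 0")
      case False
      then have "((\<lambda>x. of_nat n powr (-x)) has_field_derivative Ln (of_nat n) * of_nat n powr (-x) * (-1)) (at x)"
        by (intro DERIV_chain2[OF has_field_derivative_powr_right]) (auto intro!: derivative_eq_intros)
      from DERIV_cmult[OF this, of "of_real (a n)"] False show ?thesis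
        by (simp add: Ln_of_nat algebra_simps)
    qed auto
    fix x assume x: "x \<in> ?S"
    let ?d = "(Re x - 1) / 2"
    have "norm (of_real (a n) * of_nat n powr (-y) :: complex) \<le> (1 + \<bar>ln (real n)\<bar>) * real n powr (-((1 + Re x) / 2))"
      if "y \<in> ball x ?d \<inter> ?S" for n y
    proof (rule dirichlet_term_le)
      have "\<bar>Re x - Re y\<bar> < ?d"
        using that abs_Re_le_cmod[of "x - y"] by (auto simp: dist_norm)
      then show "(1 + Re x) / 2 \<le> Re y" by (simp add: abs_if field_simps split: if_splits)
    qed
    moreover have "?d > 0" using x by auto
    moreover have "summable (\<lambda>n. (1 + \<bar>ln (real n)\<bar>) * real n powr (-((1 + Re x) / 2)))"
      by (rule summable_dirichlet_majorant) (use x in simp)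
    ultimately show "\<exists>d h. 0 < d \<and> summable h \<and> (\<forall>\<^sub>F n in sequentially. \<forall>y\<in>ball x d \<inter> ?S.
        norm (of_real (a n) * of_nat n powr (-y) :: complex) \<le> h n)"
      by (intro exI[of _ ?d] exI[of _ "\<lambda>n. (1 + \<bar>ln (real n)\<bar>) * real n powr (-((1 + Re x) / 2))"]
        conjI always_eventually) auto
  qed
  then obtain g g' where g: "\<And>x. Re x > 1 \<Longrightarrow> ((\<lambda>n. of_real (a n) * of_nat n powr (-x)) sums g x)"
     "\<And>x. Re x > 1 \<Longrightarrow> ((\<lambda>n. - of_real (a n * ln (real n)) * of_nat n powr (-x)) sums g' x)"
     "\<And>x. Re x > 1 \<Longrightarrow> (g has_field_derivative g' x) (at x)"
    by auto
  have "dirichlet_series a x = g x" if "Re x > 1" for x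
    using g(1)[OF that] dirichlet_series_sums[OF that] sums_unique2 by blast
  then have "(dirichlet_series a has_field_derivative g' s) (at s)"
    using assms open_halfspace_Re_gt[of 1]
    by (intro has_field_derivative_transform_within_open[OF g(3)[OF assms], of ?S]) auto
  then show ?thesis by (rule that[OF g(2)[OF assms]])
qed

end

abbreviation zeta_series :: "complex \<Rightarrow> complex" where
  "zeta_series \<equiv> dirichlet_series (\<lambda>_. 1)"

abbreviation mangoldt_series :: "complex \<Rightarrow> complex" where
  "mangoldt_series \<equiv> dirichlet_series mangoldt"

lemma mangoldt_bound: "\<bar>mangoldt n :: real\<bar> \<le> 1 + \<bar>ln (real n)\<bar>"
proof (cases "n = 0")
  case False
  then show ?thesis using mangoldt_le[of n] mangoldt_nonneg[of n] by simp
qed auto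

lemma one_bound: "\<bar>1 :: real\<bar> \<le> 1 + \<bar>ln (real n)\<bar>"
  by simp

lemma has_sum_dirichlet_series:
  assumes "\<And>n. \<bar>a n\<bar> \<le> 1 + \<bar>ln (real n)\<bar>" "Re s > 1"
  shows "((\<lambda>n. of_real (a n) * of_nat n powr (-s)) has_sum dirichlet_series a s) {0<..}"
proof -
  have "((\<lambda>n. of_real (a n) * of_nat n powr (-s)) has_sum dirichlet_series a s) UNIV"
    by (rule norm_summable_imp_has_sum[OF summable_norm_dirichlet dirichlet_series_sums]) (use assms in auto)
  then show ?thesis
    by (rule has_sum_cong_neutral[THEN iffD1, rotated -1]) auto
qed

text \<open>The identity behind it is that \<open>mangoldt d\<close> summed over the divisors
  \<open>d\<close> of \<open>n\<close> gives \<open>ln n\<close>. Absolute summability of the double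
  series permits grouping its terms by the product \<open>n = d * k\<close>.\<close>

lemma mangoldt_times_zeta_sums:
  assumes s: "Re s > 1"
  shows "(\<lambda>n. of_real (ln (real n)) * of_nat n powr (-s)) sums (mangoldt_series s * zeta_series s)"
proof -
  define f where "f = (\<lambda>(d :: nat, k :: nat). (of_real (mangoldt d) * of_nat d powr (-s)) * of_nat k powr (-s) :: complex)"
  note L = has_sum_dirichlet_series[OF mangoldt_bound s]
  have Z: "((\<lambda>n. of_nat n powr (-s)) has_sum zeta_series s) {0<..}"
    using has_sum_dirichlet_series[OF one_bound s] by simp
  have N: "(\<lambda>n. norm (of_real (a n) * of_nat n powr (-s) :: complex)) summable_on {0<..}"
    if "\<And>n. \<bar>a n\<bar> \<le> 1 + \<bar>ln (real n)\<bar>" for a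
    by (rule summable_on_subset_banach[of _ UNIV])
       (use summable_norm_dirichlet[of a s] that s in \<open>auto intro!: norm_summable_imp_summable_on\<close>)
  have "(\<lambda>q. norm (f q)) summable_on {0<..} \<times> {0<..}"
  proof (rule summable_on_SigmaI)
    show "((\<lambda>y. norm (f (x, y))) has_sum norm (of_real (mangoldt x) * of_nat x powr (-s) :: complex) *
       (\<Sum>\<^sub>\<infinity>n\<in>{0<..}. norm (of_nat n powr (-s) :: complex))) {0<..}" for x
      unfolding f_def prod.case norm_mult[of "_ * _"] 
      by (intro has_sum_cmult_right has_sum_infsum) (use N[OF one_bound] in simp)
    show "(\<lambda>x. norm (of_real (mangoldt x) * of_nat x powr (-s) :: complex) *
       (\<Sum>\<^sub>\<infinity>n\<in>{0<..}. norm (of_nat n powr (-s) :: complex))) summable_on {0<..}"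
      by (rule summable_on_cmult_left[OF N[OF mangoldt_bound]])
  qed auto
  then have "f summable_on {0<..} \<times> {0<..}" by (rule abs_summable_summable)
  then have "(f has_sum (mangoldt_series s * zeta_series s)) ({0<..} \<times> {0<..})"
    by (rule has_sum_SigmaI[rotated 2])
       (use has_sum_cmult_left[OF L, of "zeta_series s"] in
         \<open>auto simp: f_def intro!: has_sum_cmult_right[OF Z]\<close>)
  also have "?this \<longleftrightarrow> ((\<lambda>(n, d). of_real (mangoldt d) * of_nat n powr (-s)) has_sum (mangoldt_series s * zeta_series s))
      (SIGMA n:{0<..}. {d. d dvd n})"
    by (rule has_sum_reindex_bij_witness[of _ "\<lambda>(n, d). (d, n div d)" "\<lambda>(d, k). (d * k, d)"])
       (auto simp: f_def powr_times_real mult.assoc dest: dvd_pos_nat intro!: Nat.gr0I elim!: dvdE)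
  finally have "((\<lambda>n. of_real (ln (real n)) * of_nat n powr (-s)) has_sum (mangoldt_series s * zeta_series s)) {0<..}"
  proof (rule has_sum_SigmaD)
    fix n :: nat assume n: "n \<in> {0<..}"
    then have "(\<Sum>d | d dvd n. of_real (mangoldt d) * of_nat n powr (-s)) = (of_real (ln (real n)) * of_nat n powr (-s) :: complex)"
      using mangoldt_sum[of n, where ?'a = complex] by (simp flip: sum_distrib_right)
    then show "((\<lambda>d. case (n, d) of (n, d) \<Rightarrow> of_real (mangoldt d) * of_nat n powr (-s)) has_sum
       (of_real (ln (real n)) * of_nat n powr (-s) :: complex)) {d. d dvd n}"
      using n by (intro has_sum_finiteI) auto
  qed
  then have "((\<lambda>n. of_real (ln (real n)) * of_nat n powr (-s)) has_sum (mangoldt_series s * zeta_series s)) UNIV"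
    by (rule has_sum_cong_neutral[THEN iffD1, rotated -1]) auto
  then show ?thesis by (rule has_sum_imp_sums)
qed

lemma zeta_series_derivative:
  assumes "Re s > 1"
  shows "(zeta_series has_field_derivative - (mangoldt_series s * zeta_series s)) (at s)"
proof -
  obtain D where D: "(\<lambda>n. - of_real (1 * ln (real n)) * of_nat n powr (-s)) sums D"
    "(zeta_series has_field_derivative D) (at s)"
    using dirichlet_series_derivative[OF one_bound assms] .
  have "(\<lambda>n. - of_real (1 * ln (real n)) * of_nat n powr (-s)) sums (- (mangoldt_series s * zeta_series s))"
    using sums_minus[OF mangoldt_times_zeta_sums[OF assms]] by simp
  then show ?thesis using D sums_unique2 by blast
qed

section \<open>Nonvanishing of the zeta function on the line Re s = 1\<close>

definition zeta_term :: "nat \<Rightarrow> complex \<Rightarrow> complex" where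
  "zeta_term n s = (s - 1) * of_nat (Suc n) powr (-s)
     - (of_nat (Suc n) powr (1 - s) - of_nat (Suc (Suc n)) powr (1 - s))"

text \<open>The function \<open>(s - 1) \<zeta>(s)\<close>, continued to \<open>Re s > 0\<close>: the term of index \<open>n - 1\<close> is
  \<open>(s - 1)\<close> times the integral of \<open>n\<^sup>-\<^sup>s - x\<^sup>-\<^sup>s\<close> over \<open>[n, n + 1]\<close>.\<close>

definition pole_free_zeta :: "complex \<Rightarrow> complex" where
  "pole_free_zeta s = 1 + (\<Sum>n. zeta_term n s)"

lemma norm_powr_diff_le:
  fixes N :: real and w :: complex
  assumes N: "N > 0" "x \<in> {N..N + 1}" and w: "Re w \<le> 1"
  shows "norm (of_real x powr w - of_real N powr w) \<le> norm w * N powr (Re w - 1)"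
proof -
  define S :: "complex set" where "S = closed_segment (of_real N) (of_real (N + 1))"
  have S: "S = of_real ` {N..N + 1}"
    unfolding S_def closed_segment_of_real by (simp add: closed_segment_eq_real_ivl)
  have "norm (of_real x powr w - of_real N powr w) \<le> (norm w * N powr (Re w - 1)) * norm (of_real x - of_real N :: complex)"
  proof (rule field_differentiable_bound[of S])
    show "convex S" by (simp add: S_def)
    fix z assume "z \<in> S"
    then obtain y where y: "z = of_real y" "N \<le> y" by (auto simp: S)
    then have "z \<notin> \<real>\<^sub>\<le>\<^sub>0" using N by (auto simp: complex_nonpos_Reals_iff)
    then show "((\<lambda>z. z powr w) has_field_derivative w * z powr (w - 1)) (at z within S)"
      by (rule has_field_derivative_at_within[OF has_field_derivative_powr])
    show "norm (w * z powr (w - 1)) \<le> norm w * N powr (Re w - 1)"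
      using y N w by (auto simp: norm_mult norm_powr_real_powr intro!: mult_left_mono powr_mono2')
  qed (use N in \<open>auto simp: S\<close>)
  also have "norm (of_real x - of_real N :: complex) = x - N"
    using N by (simp flip: of_real_diff)
  also have "(norm w * N powr (Re w - 1)) * (x - N) \<le> norm w * N powr (Re w - 1)"
    using N by (intro mult_left_le) auto
  finally show ?thesis .
qed

text \<open>The term is the increment over \<open>[N, N + 1]\<close> of a function \<open>g\<close>
  whose derivative \<open>(s - 1) (N^(-s) - z^(-s))\<close> vanishes at \<open>N\<close>. Bounding
  this derivative by \<open>norm_powr_diff_le\<close> gains a further factor \<open>1 / N\<close>,
  which makes the terms summable for \<open>Re s > 0\<close> instead of
  \<open>Re s > 1\<close>.\<close>

lemma norm_zeta_term_le:
  assumes s: "Re s > 0"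
  shows "norm (zeta_term n s) \<le> norm (s - 1) * (norm s * real (Suc n) powr (- Re s - 1))"
proof -
  define N where "N = real (Suc n)"
  have N: "N > 0" "of_nat (Suc n) = complex_of_real N" "of_nat (Suc (Suc n)) = complex_of_real (N + 1)"
    by (simp_all add: N_def)
  define S :: "complex set" where "S = closed_segment (of_real N) (of_real (N + 1))"
  have S: "S = of_real ` {N..N + 1}"
    unfolding S_def closed_segment_of_real by (simp add: closed_segment_eq_real_ivl)
  define g where "g z = (s - 1) * of_real N powr (-s) * z + z powr (1 - s)" for z
  have "norm (g (of_real (N + 1)) - g (of_real N)) \<le>
      (norm (s - 1) * (norm s * N powr (- Re s - 1))) * norm (of_real (N + 1) - of_real N :: complex)"
  proof (rule field_differentiable_bound[of S])
    show "convex S" by (simp add: S_def)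
    fix z assume "z \<in> S"
    then obtain y where y: "z = of_real y" "N \<le> y" "y \<le> N + 1" by (auto simp: S)
    then have z: "z \<notin> \<real>\<^sub>\<le>\<^sub>0" using N by (auto simp: complex_nonpos_Reals_iff)
    have "((\<lambda>z. z powr (1 - s)) has_field_derivative (1 - s) * z powr (1 - s - 1)) (at z within S)"
      by (rule has_field_derivative_at_within[OF has_field_derivative_powr[OF z]])
    from DERIV_add[OF DERIV_cmult[OF DERIV_ident, of "(s - 1) * of_real N powr (-s)"] this]
    show "(g has_field_derivative (s - 1) * (of_real N powr (-s) - z powr (-s))) (at z within S)"
      unfolding g_def by (simp add: algebra_simps)
    have "norm (of_real N powr (-s) - z powr (-s)) \<le> norm s * N powr (- Re s - 1)"
      using norm_powr_diff_le[OF N(1), of y "-s"] y s by (simp add: norm_minus_commute)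
    then show "norm ((s - 1) * (of_real N powr (-s) - z powr (-s))) \<le> norm (s - 1) * (norm s * N powr (- Re s - 1))"
      by (simp add: norm_mult mult_left_mono)
  qed (auto simp: S_def)
  also have "g (of_real (N + 1)) - g (of_real N) = zeta_term n s"
    unfolding g_def zeta_term_def N by (simp add: algebra_simps)
  finally show ?thesis by (simp add: N_def)
qed

lemma pole_free_zeta_1: "pole_free_zeta 1 = 1"
  by (simp add: pole_free_zeta_def zeta_term_def del: of_nat_Suc)

lemma holomorphic_zeta_term: "zeta_term n holomorphic_on A"
  unfolding zeta_term_def by (intro holomorphic_intros)

lemma pole_free_zeta_holomorphic: "pole_free_zeta holomorphic_on {s. Re s > 0}"
proof -
  let ?S = "{s. Re s > 0}"
  have "\<exists>g g'. \<forall>x \<in> ?S. ((\<lambda>n. zeta_term n x) sums g x) \<and>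
     ((\<lambda>n. deriv (zeta_term n) x) sums g' x) \<and> (g has_field_derivative g' x) (at x)"
  proof (rule series_and_derivative_comparison_local)
    show "open ?S" by (rule open_halfspace_Re_gt)
    show "(zeta_term n has_field_derivative deriv (zeta_term n) x) (at x)" for n x
      using holomorphic_derivI[OF holomorphic_zeta_term[of n UNIV]] by simp
    fix x assume x: "x \<in> ?S"
    define d where "d = Re x / 2"
    define R where "R = norm x + d"
    have d: "d > 0" using x by (simp add: d_def)
    have "norm (zeta_term n y) \<le> (R + 1) * (R * real (Suc n) powr (- d - 1))"
      if y: "y \<in> ball x d \<inter> ?S" for n y
    proof -
      have "norm (x - y) < d" using y by (simp add: dist_norm)
      then have "norm y \<le> R" "Re y \<ge> d"
        using norm_triangle_ineq3[of x y] abs_Re_le_cmod[of "x - y"] 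
        unfolding R_def d_def by (auto simp: abs_if field_simps split: if_splits)
      moreover have "norm (y - 1) \<le> norm y + 1" using norm_triangle_ineq4[of y 1] by simp
      ultimately have "norm (y - 1) * (norm y * real (Suc n) powr (- Re y - 1)) \<le> (R + 1) * (R * real (Suc n) powr (- d - 1))"
        using d by (intro mult_mono powr_mono) (auto simp: R_def)
      then show ?thesis using norm_zeta_term_le[of y n] y by auto
    qed
    moreover have "summable (\<lambda>n. (R + 1) * (R * real (Suc n) powr (- d - 1)))"
      using d by (intro summable_mult summable_Suc_iff[THEN iffD2, of "\<lambda>n. real n powr (- d - 1)"]) (simp add: summable_real_powr_iff)
    ultimately show "\<exists>d h. 0 < d \<and> summable h \<and> (\<forall>\<^sub>F n in sequentially. \<forall>y\<in>ball x d \<inter> ?S. norm (zeta_term n y) \<le> h n)"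
      using d by (intro exI[of _ d] exI[of _ "\<lambda>n. (R + 1) * (R * real (Suc n) powr (- d - 1))"]) auto
  qed
  then obtain g g' where g: "\<And>x. Re x > 0 \<Longrightarrow> (\<lambda>n. zeta_term n x) sums g x"
     "\<And>x. Re x > 0 \<Longrightarrow> (g has_field_derivative g' x) (at x)"
    by auto
  have "g holomorphic_on ?S" using g(2) holomorphic_on_open[OF open_halfspace_Re_gt] by blast
  then have "(\<lambda>s. 1 + g s) holomorphic_on ?S" by (intro holomorphic_intros)
  then show ?thesis
    by (rule holomorphic_transform) (use g(1) sums_unique in \<open>auto simp: pole_free_zeta_def\<close>)
qed

text \<open>For \<open>Re s > 1\<close> the subtracted differences telescope to \<open>1\<close>,
  which cancels the leading \<open>1\<close> of \<open>pole_free_zeta\<close>.\<close>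

lemma pole_free_zeta_eq:
  assumes s: "Re s > 1"
  shows "pole_free_zeta s = (s - 1) * zeta_series s"
proof -
  have "(\<lambda>n. of_nat (Suc n) powr (-s)) sums zeta_series s"
    using dirichlet_series_sums[OF one_bound s] by (subst sums_Suc_iff) simp
  then have 1: "(\<lambda>n. (s - 1) * of_nat (Suc n) powr (-s)) sums ((s - 1) * zeta_series s)"
    by (rule sums_mult)
  have "(\<lambda>n. real (Suc n) powr (1 - Re s)) \<longlonglongrightarrow> 0"
    using s by real_asymp
  then have "(\<lambda>n. of_nat (Suc n) powr (1 - s) :: complex) \<longlonglongrightarrow> 0"
    by (subst tendsto_norm_zero_iff[symmetric]) (simp del: of_nat_Suc)
  from telescope_sums'[OF this]
  have 2: "(\<lambda>n. of_nat (Suc n) powr (1 - s) - of_nat (Suc (Suc n)) powr (1 - s)) sums (1 :: complex)"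
    by simp
  have "(\<lambda>n. zeta_term n s) sums ((s - 1) * zeta_series s - 1)"
    unfolding zeta_term_def by (rule sums_diff[OF 1 2])
  then show ?thesis by (simp add: pole_free_zeta_def sums_iff)
qed

text \<open>The limit \<open>m\<close> is the order of \<open>f\<close> at \<open>a\<close>.\<close>

lemma log_derivative_limit:
  fixes f :: "complex \<Rightarrow> complex"
  assumes f: "f holomorphic_on S" and S: "open S" "connected S" and a: "a \<in> S" and b: "b \<in> S" "f b \<noteq> 0"
  obtains m :: nat where "m = 0 \<longleftrightarrow> f a \<noteq> 0"
    "((\<lambda>x. of_real x * (deriv f (a + of_real x) / f (a + of_real x))) \<longlongrightarrow> of_nat m) (at_right 0)"
proof -
  obtain m g r where mgr: "m = 0 \<longleftrightarrow> f a \<noteq> 0" "r > 0" "ball a r \<subseteq> S" "g holomorphic_on ball a r"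
    "\<And>w. w \<in> ball a r \<Longrightarrow> f w = (w - a) ^ m * g w" "\<And>w. w \<in> ball a r \<Longrightarrow> g w \<noteq> 0"
  proof (cases "f a = 0")
    case True
    then have "\<not> f constant_on S" using a b by (metis constant_on_def)
    then show ?thesis
      using holomorphic_factor_zero_nonconstant[OF f S a True] that True by (metis less_numeral_extra(3))
  next
    case False
    have "continuous (at a) f"
      using f S(1) a continuous_on_eq_continuous_at holomorphic_on_imp_continuous_on by blast
    then obtain e where e: "e > 0" "\<And>w. dist a w < e \<Longrightarrow> f w \<noteq> 0"
      using continuous_at_avoid[of a f 0] False by auto
    obtain e' where e': "e' > 0" "ball a e' \<subseteq> S" using S(1) a openE by blast
    show ?thesis
    proof (rule that[of 0 "min e e'" f])
      show "ball a (min e e') \<subseteq> S" using e' by auto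
      then show "f holomorphic_on ball a (min e e')" using f holomorphic_on_subset by blast
    qed (use False e e' in auto)
  qed
  have gh: "(g has_field_derivative deriv g w) (at w)" if "w \<in> ball a r" for w
    using holomorphic_derivI[OF mgr(4)] that by simp
  have deriv: "deriv f w = of_nat m * (w - a) ^ (m - 1) * g w + (w - a) ^ m * deriv g w" if w: "w \<in> ball a r" for w
  proof (rule DERIV_imp_deriv)
    have "((\<lambda>w. (w - a) ^ m * g w) has_field_derivative of_nat m * (w - a) ^ (m - 1) * g w + (w - a) ^ m * deriv g w) (at w)"
      by (auto intro!: derivative_eq_intros gh[OF w])
    then show "(f has_field_derivative of_nat m * (w - a) ^ (m - 1) * g w + (w - a) ^ m * deriv g w) (at w)"
      by (rule has_field_derivative_transform_within_open[of _ _ _ "ball a r"]) (use w mgr(5) in auto)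
  qed
  \<comment> \<open>The logarithmic derivative of \<open>(w - a)^m * g w\<close> is
    \<open>m / (w - a) + g' / g\<close>; after multiplication by \<open>x\<close> the first part is
    \<open>m\<close> and the second tends to zero, as \<open>g\<close> is nonzero at
    \<open>a\<close>.\<close>
  have eq: "of_real x * (deriv f (a + of_real x) / f (a + of_real x))
      = of_nat m + of_real x * (deriv g (a + of_real x) / g (a + of_real x))"
    if x: "x > 0" "x < r" for x :: real
  proof -
    have w: "a + of_real x \<in> ball a r" using x by (simp add: dist_norm)
    have "(of_real x :: complex) * of_real x ^ (m - 1) * of_nat m = of_nat m * of_real x ^ m"
      by (cases m) auto
    then show ?thesis
      using x mgr(5,6)[OF w] deriv[OF w] by (simp add: field_simps)
  qed
  have "deriv g holomorphic_on ball a r" using mgr(4) by (intro holomorphic_deriv) auto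
  then have "continuous (at a) (\<lambda>w. deriv g w / g w)"
    using mgr(2,4,6) holomorphic_on_imp_continuous_on[of _ "ball a r"]
    by (intro continuous_divide) (auto simp: continuous_on_eq_continuous_at)
  then have "((\<lambda>w. deriv g w / g w) \<longlongrightarrow> deriv g a / g a) (at a)"
    by (simp add: continuous_at)
  moreover have "filterlim (\<lambda>x. a + of_real x) (at a) (at_right 0)"
    unfolding filterlim_at by (auto intro!: tendsto_eq_intros simp: eventually_at_filter)
  ultimately have lim: "((\<lambda>x. deriv g (a + of_real x) / g (a + of_real x)) \<longlongrightarrow> deriv g a / g a) (at_right 0)"
    by (rule filterlim_compose)
  have "((\<lambda>x. of_nat m + of_real x * (deriv g (a + of_real x) / g (a + of_real x))) \<longlongrightarrow> of_nat m + of_real 0 * (deriv g a / g a)) (at_right 0)"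
    by (intro tendsto_add[OF tendsto_const tendsto_mult[OF _ lim]] tendsto_of_real tendsto_ident_at)
  moreover have "\<forall>\<^sub>F x in at_right 0. of_real x * (deriv f (a + of_real x) / f (a + of_real x))
      = of_nat m + of_real x * (deriv g (a + of_real x) / g (a + of_real x))"
    using mgr(2) eq by (auto simp: eventually_at_right_field intro!: exI[of _ r])
  ultimately have "((\<lambda>x. of_real x * (deriv f (a + of_real x) / f (a + of_real x))) \<longlongrightarrow> of_nat m) (at_right 0)"
    by (subst tendsto_cong) simp_all
  then show ?thesis by (rule that[OF mgr(1)])
qed

text \<open>The product form avoids a division by \<open>pole_free_zeta s\<close>, whose
  nonvanishing for \<open>Re s > 1\<close> is deduced from this very formula.\<close>

lemma pole_free_zeta_deriv:
  assumes s: "Re s > 1"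
  shows "deriv pole_free_zeta s = pole_free_zeta s * (1 / (s - 1) - mangoldt_series s)"
proof -
  have "((\<lambda>s. (s - 1) * zeta_series s) has_field_derivative
      zeta_series s + (s - 1) * - (mangoldt_series s * zeta_series s)) (at s)"
    by (auto intro!: derivative_eq_intros zeta_series_derivative[OF s])
  then have "(pole_free_zeta has_field_derivative
      zeta_series s + (s - 1) * - (mangoldt_series s * zeta_series s)) (at s)"
    by (rule has_field_derivative_transform_within_open[where S = "{s. Re s > 1}"])
       (use s in \<open>auto simp: pole_free_zeta_eq open_halfspace_Re_gt\<close>)
  then have "deriv pole_free_zeta s = zeta_series s + (s - 1) * - (mangoldt_series s * zeta_series s)"
    by (rule DERIV_imp_deriv)
  moreover have "s - 1 \<noteq> 0" using s by auto
  ultimately show ?thesis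
    unfolding pole_free_zeta_eq[OF s] by (simp add: right_diff_distrib)
qed

lemma isCont_mangoldt_series:
  assumes "Re s > 1"
  shows "isCont mangoldt_series s"
  using dirichlet_series_derivative[OF mangoldt_bound assms] DERIV_isCont by metis

lemma pole_free_zeta_log_derivative_limit:
  assumes "Re a > 0"
  obtains m :: nat where "m = 0 \<longleftrightarrow> pole_free_zeta a \<noteq> 0"
    "((\<lambda>x. of_real x * (deriv pole_free_zeta (a + of_real x) / pole_free_zeta (a + of_real x))) \<longlongrightarrow> of_nat m) (at_right 0)"
proof (rule log_derivative_limit[OF pole_free_zeta_holomorphic])
  show "open {s. Re s > 0}" by (rule open_halfspace_Re_gt)
  show "connected {s. Re s > 0}" by (intro convex_connected convex_halfspace_Re_gt)
  show "pole_free_zeta 1 \<noteq> 0" by (simp add: pole_free_zeta_1)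
qed (use assms that in auto)

text \<open>A zero would have positive order and so force a pole of the logarithmic derivative. But
  away from zeros that derivative agrees with \<open>q\<close>, which is continuous at
  \<open>a\<close>.\<close>

lemma pole_free_zeta_nonzero_Re_gt_1:
  assumes a: "Re a > 1"
  shows "pole_free_zeta a \<noteq> 0"
proof -
  have "Re a > 0" using a by simp
  then obtain m where m: "m = 0 \<longleftrightarrow> pole_free_zeta a \<noteq> 0"
    "((\<lambda>x. of_real x * (deriv pole_free_zeta (a + of_real x) / pole_free_zeta (a + of_real x))) \<longlongrightarrow> of_nat m) (at_right 0)"
    by (rule pole_free_zeta_log_derivative_limit)
  define q where "q w = 1 / (w - 1) - mangoldt_series w" for w
  have "isCont q a" unfolding q_def using a
    by (intro continuous_intros isCont_mangoldt_series) auto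
  then have q: "((\<lambda>x. q (a + of_real x)) \<longlongrightarrow> q a) (at_right 0)"
    by (rule isCont_tendsto_compose) (auto intro!: tendsto_eq_intros)
  have "((\<lambda>x. of_real x * q (a + of_real x)) \<longlongrightarrow> of_real 0 * q a) (at_right 0)"
    by (intro tendsto_mult q tendsto_of_real tendsto_ident_at)
  then have "((\<lambda>x. norm (of_real x * q (a + of_real x))) \<longlongrightarrow> 0) (at_right 0)"
    using tendsto_norm_zero by simp
  \<comment> \<open>Only an inequality is claimed: at a zero of the denominator the quotient is
    \<open>0\<close> by the convention for division.\<close>
  moreover have "\<forall>\<^sub>F x in at_right 0. norm (of_real x * (deriv pole_free_zeta (a + of_real x) / pole_free_zeta (a + of_real x)))
      \<le> norm (of_real x * q (a + of_real x))"
    using a pole_free_zeta_deriv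
    by (auto simp: eventually_at_right_field q_def norm_mult norm_divide intro!: exI[of _ 1] mult_left_mono)
  ultimately have "((\<lambda>x. of_real x * (deriv pole_free_zeta (a + of_real x) / pole_free_zeta (a + of_real x))) \<longlongrightarrow> 0) (at_right 0)"
    by (rule Lim_null_comparison[rotated])
  from tendsto_unique[OF _ this m(2)] have "m = 0" by simp
  then show ?thesis using m(1) by simp
qed

lemma mangoldt_series_eq:
  assumes "Re s > 1"
  shows "mangoldt_series s = 1 / (s - 1) - deriv pole_free_zeta s / pole_free_zeta s"
  using pole_free_zeta_deriv[OF assms] pole_free_zeta_nonzero_Re_gt_1[OF assms] by simp

text \<open>The classical inequality \<open>3 + 4 cos \<theta> + cos (2 \<theta>) = 2 (1 + cos
  \<theta>)^2 >= 0\<close> is applied with \<open>\<theta> = t ln n\<close> to every term of the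
  series.\<close>

lemma mangoldt_series_3_4_1:
  assumes "\<sigma> > 1"
  shows "3 * Re (mangoldt_series (of_real \<sigma>)) + 4 * Re (mangoldt_series (Complex \<sigma> t))
    + Re (mangoldt_series (Complex \<sigma> (2 * t))) \<ge> 0"
proof -
  have Re_term: "Re (of_real (mangoldt n) * of_nat n powr (- Complex \<sigma> u)) = mangoldt n * (real n powr (-\<sigma>) * cos (u * ln (real n)))" for u n
  proof (cases "n = 0")
    case False
    then show ?thesis
      by (simp add: powr_def Ln_of_nat Re_exp Im_exp exp_of_real powr_def mult.commute)
  qed auto
  have S: "(\<lambda>n. mangoldt n * (real n powr (-\<sigma>) * cos (u * ln (real n)))) sums Re (mangoldt_series (Complex \<sigma> u))" for u
    using sums_Re[OF dirichlet_series_sums[OF mangoldt_bound, of "Complex \<sigma> u"]] assms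
    unfolding Re_term by simp
  have A: "(\<lambda>n. 3 * (mangoldt n * (real n powr (-\<sigma>) * cos (0 * ln (real n)))) + 4 * (mangoldt n * (real n powr (-\<sigma>) * cos (t * ln (real n))))
      + mangoldt n * (real n powr (-\<sigma>) * cos (2 * t * ln (real n)))) sums
     (3 * Re (mangoldt_series (Complex \<sigma> 0)) + 4 * Re (mangoldt_series (Complex \<sigma> t))
    + Re (mangoldt_series (Complex \<sigma> (2 * t))))"
    by (intro sums_add sums_mult S)
  have B: "3 * (mangoldt n * (real n powr (-\<sigma>) * cos (0 * ln (real n)))) + 4 * (mangoldt n * (real n powr (-\<sigma>) * cos (t * ln (real n))))
      + mangoldt n * (real n powr (-\<sigma>) * cos (2 * t * ln (real n))) \<ge> (0 :: real)" for n
  proof -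
    have "3 * (mangoldt n * (real n powr (-\<sigma>) * cos (0 * ln (real n)))) + 4 * (mangoldt n * (real n powr (-\<sigma>) * cos (t * ln (real n))))
      + mangoldt n * (real n powr (-\<sigma>) * cos (2 * t * ln (real n)))
      = mangoldt n * real n powr (-\<sigma>) * (2 * (1 + cos (t * ln (real n)))\<^sup>2)"
    proof -
      have *: "cos (2 * t * ln (real n)) = 2 * (cos (t * ln (real n)))\<^sup>2 - 1"
        using cos_double_cos[of "t * ln (real n)"] by (simp add: mult.assoc)
      show ?thesis unfolding * by (simp add: algebra_simps power2_eq_square)
    qed
    then show ?thesis by (simp add: mangoldt_nonneg)
  qed
  have "3 * Re (mangoldt_series (Complex \<sigma> 0)) + 4 * Re (mangoldt_series (Complex \<sigma> t))
    + Re (mangoldt_series (Complex \<sigma> (2 * t))) \<ge> 0"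
    by (rule sums_le[OF B sums_zero A])
  moreover have "Complex \<sigma> 0 = of_real \<sigma>" by (simp add: complex_of_real_def)
  ultimately show ?thesis by simp
qed

text \<open>If \<open>m u\<close> is the order of the zero at \<open>1 + i u\<close>, then
  \<open>x\<close> times the real part of \<open>mangoldt_series\<close> at
  \<open>1 + x + i u\<close> tends to \<open>1 - m 0\<close> for \<open>u = 0\<close> and to
  \<open>- m u\<close> otherwise. In the limit the 3-4-1 inequality becomes
  \<open>3 - 4 m(t) - m(2 t) >= 0\<close>, because \<open>m 0 = 0\<close>, and a natural number
  \<open>m(t)\<close> satisfying it is zero.\<close>

lemma pole_free_zeta_nonzero_Re_eq_1:
  "pole_free_zeta (Complex 1 t) \<noteq> 0"
proof (cases "t = 0")
  case True
  then have "Complex 1 t = 1" by (simp add: complex_eq_iff)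
  then show ?thesis by (simp add: pole_free_zeta_1)
next
  case t: False
  have "\<forall>u. \<exists>m::nat. (m = 0 \<longleftrightarrow> pole_free_zeta (Complex 1 u) \<noteq> 0) \<and>
     ((\<lambda>x. x * Re (mangoldt_series (Complex (1 + x) u))) \<longlongrightarrow> (if u = 0 then 1 else 0) - real m) (at_right 0)"
  proof
    fix u
    obtain m where m: "m = 0 \<longleftrightarrow> pole_free_zeta (Complex 1 u) \<noteq> 0"
      "((\<lambda>x. of_real x * (deriv pole_free_zeta (Complex 1 u + of_real x) / pole_free_zeta (Complex 1 u + of_real x))) \<longlongrightarrow> of_nat m) (at_right 0)"
      by (rule pole_free_zeta_log_derivative_limit[of "Complex 1 u"]) simp
    have "((\<lambda>x. of_real x / (Complex 1 u + of_real x - 1)) \<longlongrightarrow> (if u = 0 then 1 else 0)) (at_right 0)"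
    proof (cases "u = 0")
      case True
      have "\<forall>\<^sub>F x in at_right 0. of_real x / (Complex 1 u + of_real x - 1) = 1"
        using True by (auto simp: eventually_at_right_field complex_eq_iff Re_divide Im_divide power2_eq_square intro!: exI[of _ 1])
      then show ?thesis using True by (simp add: tendsto_eventually)
    next
      case False
      then have "Complex 1 u + of_real 0 - 1 \<noteq> 0" by (simp add: complex_eq_iff)
      then have "((\<lambda>x. of_real x / (Complex 1 u + of_real x - 1)) \<longlongrightarrow> of_real 0 / (Complex 1 u + of_real 0 - 1)) (at_right 0)"
        by (intro tendsto_intros)
      then show ?thesis using False by simp
    qed
    from tendsto_Re[OF tendsto_diff[OF this m(2)]]
    have "((\<lambda>x. Re (of_real x / (Complex 1 u + of_real x - 1) - of_real x * (deriv pole_free_zeta (Complex 1 u + of_real x) / pole_free_zeta (Complex 1 u + of_real x))))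
       \<longlongrightarrow> (if u = 0 then 1 else 0) - real m) (at_right 0)"
      by (simp split: if_splits)
    moreover have "\<forall>\<^sub>F x in at_right 0. x * Re (mangoldt_series (Complex (1 + x) u)) =
       Re (of_real x / (Complex 1 u + of_real x - 1) - of_real x * (deriv pole_free_zeta (Complex 1 u + of_real x) / pole_free_zeta (Complex 1 u + of_real x)))"
    proof -
      have "x * Re (mangoldt_series (Complex (1 + x) u)) =
       Re (of_real x / (Complex 1 u + of_real x - 1) - of_real x * (deriv pole_free_zeta (Complex 1 u + of_real x) / pole_free_zeta (Complex 1 u + of_real x)))"
        if "x > 0" for x
      proof -
        have eq: "Complex 1 u + of_real x = Complex (1 + x) u" by (simp add: complex_eq_iff)
        have "x * Re (mangoldt_series (Complex (1 + x) u)) = Re (of_real x * mangoldt_series (Complex (1 + x) u))" by simp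
        also have "of_real x * mangoldt_series (Complex (1 + x) u) =
          of_real x / (Complex 1 u + of_real x - 1) - of_real x * (deriv pole_free_zeta (Complex 1 u + of_real x) / pole_free_zeta (Complex 1 u + of_real x))"
          using that unfolding eq by (subst mangoldt_series_eq) (auto simp: right_diff_distrib)
        finally show ?thesis .
      qed
      then show ?thesis by (auto simp: eventually_at_right_field intro!: exI[of _ 1])
    qed
    ultimately have "((\<lambda>x. x * Re (mangoldt_series (Complex (1 + x) u))) \<longlongrightarrow> (if u = 0 then 1 else 0) - real m) (at_right 0)"
      by (subst tendsto_cong)
    then show "\<exists>m::nat. (m = 0 \<longleftrightarrow> pole_free_zeta (Complex 1 u) \<noteq> 0) \<and>
     ((\<lambda>x. x * Re (mangoldt_series (Complex (1 + x) u))) \<longlongrightarrow> (if u = 0 then 1 else 0) - real m) (at_right 0)"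
      by (intro exI[of _ m] conjI m(1))
  qed
  from choice[OF this] obtain m :: "real \<Rightarrow> nat" where
    m: "\<forall>u. (m u = 0 \<longleftrightarrow> pole_free_zeta (Complex 1 u) \<noteq> 0) \<and>
     ((\<lambda>x. x * Re (mangoldt_series (Complex (1 + x) u))) \<longlongrightarrow> (if u = 0 then 1 else 0) - real (m u)) (at_right 0)"
    by (rule exE)
  note m0 = m[THEN spec, of 0, THEN conjunct1] m[THEN spec, of 0, THEN conjunct2, unfolded simp_thms if_True]
  have m1: "((\<lambda>x. x * Re (mangoldt_series (Complex (1 + x) t))) \<longlongrightarrow> 0 - real (m t)) (at_right 0)"
    using m[THEN spec, of t, THEN conjunct2] t by (simp only: if_False)
  have m2: "((\<lambda>x. x * Re (mangoldt_series (Complex (1 + x) (2 * t)))) \<longlongrightarrow> 0 - real (m (2 * t))) (at_right 0)"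
    using m[THEN spec, of "2 * t", THEN conjunct2] t by (simp split: if_splits)
  have "Complex 1 0 = 1" by (simp add: complex_eq_iff)
  then have "m 0 = 0" using m0(1) by (simp add: pole_free_zeta_1)
  have "((\<lambda>x. 3 * (x * Re (mangoldt_series (Complex (1 + x) 0))) + 4 * (x * Re (mangoldt_series (Complex (1 + x) t)))
      + x * Re (mangoldt_series (Complex (1 + x) (2 * t)))) \<longlongrightarrow> 3 * (1 - real (m 0)) + 4 * (0 - real (m t)) + (0 - real (m (2 * t)))) (at_right 0)"
    by (intro tendsto_add tendsto_mult tendsto_const m0 m1 m2)
  moreover have "\<forall>\<^sub>F x in at_right 0. 3 * (x * Re (mangoldt_series (Complex (1 + x) 0))) + 4 * (x * Re (mangoldt_series (Complex (1 + x) t)))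
      + x * Re (mangoldt_series (Complex (1 + x) (2 * t))) \<ge> 0"
  proof -
    have "3 * (x * Re (mangoldt_series (Complex (1 + x) 0))) + 4 * (x * Re (mangoldt_series (Complex (1 + x) t)))
      + x * Re (mangoldt_series (Complex (1 + x) (2 * t))) \<ge> 0" if "x > 0" for x
    proof -
      have "x * (3 * Re (mangoldt_series (of_real (1 + x))) + 4 * Re (mangoldt_series (Complex (1 + x) t))
       + Re (mangoldt_series (Complex (1 + x) (2 * t)))) \<ge> 0"
        using mangoldt_series_3_4_1[of "1 + x" t] that by (intro mult_nonneg_nonneg) auto
      moreover have "of_real (1 + x) = Complex (1 + x) 0" by (simp add: complex_of_real_def)
      ultimately show ?thesis by (simp only: algebra_simps)
    qed
    then show ?thesis by (auto simp: eventually_at_right_field intro!: exI[of _ 1])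
  qed
  ultimately have "3 * (1 - real (m 0)) + 4 * (0 - real (m t)) + (0 - real (m (2 * t))) \<ge> 0"
    by (rule tendsto_lowerbound) simp
  then have "m t = 0" using \<open>m 0 = 0\<close> by simp
  then show ?thesis using m[THEN spec, of t, THEN conjunct1] by simp
qed

text \<open>With \<open>Z\<close> for \<open>pole_free_zeta\<close>, the difference equals
  \<open>(1 - Z s) / (s - 1) - Z' s / Z s\<close> for \<open>Re s > 1\<close>: the two poles at 1
  cancel because \<open>Z 1 = 1\<close>. The second term is holomorphic wherever \<open>Z\<close> is
  nonzero, an open set that contains the closed half-plane.\<close>

lemma mangoldt_minus_zeta_continuation:
  obtains H U where "open U" "{s. Re s \<ge> 1} \<subseteq> U" "H holomorphic_on U"
    "\<And>s. Re s > 1 \<Longrightarrow> H s = mangoldt_series s - zeta_series s"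
proof -
  define S where "S = {s::complex. Re s > 0}"
  define U where "U = S \<inter> pole_free_zeta -` (- {0})"
  have S: "open S" unfolding S_def by (rule open_halfspace_Re_gt)
  have ZS: "pole_free_zeta holomorphic_on S" unfolding S_def by (rule pole_free_zeta_holomorphic)
  have U: "open U" unfolding U_def
    by (rule continuous_open_preimage[OF holomorphic_on_imp_continuous_on[OF ZS] S]) auto
  have US: "U \<subseteq> S" by (auto simp: U_def)
  have "{s. Re s \<ge> 1} \<subseteq> U"
  proof
    fix s :: complex assume "s \<in> {s. Re s \<ge> 1}"
    then have s: "Re s \<ge> 1" by simp
    have "pole_free_zeta s \<noteq> 0"
    proof (cases "Re s = 1")
      case True
      then have "s = Complex 1 (Im s)" by (simp add: complex_eq_iff)
      then show ?thesis using pole_free_zeta_nonzero_Re_eq_1 by metis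
    qed (use s pole_free_zeta_nonzero_Re_gt_1 in auto)
    then show "s \<in> U" using s by (auto simp: U_def S_def)
  qed
  define g where "g s = 1 - pole_free_zeta s" for s
  define f where "f s = (if s = 1 then deriv g 1 else g s / (s - 1))" for s
  have "g holomorphic_on U" unfolding g_def
    using holomorphic_on_subset[OF ZS US] by (intro holomorphic_intros)
  then have "f holomorphic_on U"
    by (rule pole_theorem_open_0[OF _ U, of _ 1]) (auto simp: f_def g_def pole_free_zeta_1)
  moreover have "deriv pole_free_zeta holomorphic_on U"
    by (rule holomorphic_on_subset[OF holomorphic_deriv[OF ZS S] US])
  ultimately have hol: "(\<lambda>s. f s - deriv pole_free_zeta s / pole_free_zeta s) holomorphic_on U"
    using holomorphic_on_subset[OF ZS US] by (intro holomorphic_on_diff holomorphic_on_divide) (auto simp: U_def)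
  have eq: "f s - deriv pole_free_zeta s / pole_free_zeta s = mangoldt_series s - zeta_series s"
    if "Re s > 1" for s
  proof -
    have "s \<noteq> 1" using that by auto
    then have "zeta_series s = pole_free_zeta s / (s - 1)"
      by (simp add: pole_free_zeta_eq[OF that])
    then show ?thesis using \<open>s \<noteq> 1\<close>
      by (simp add: f_def g_def mangoldt_series_eq[OF that] diff_divide_distrib)
  qed
  show ?thesis by (rule that[OF U \<open>{s. Re s \<ge> 1} \<subseteq> U\<close> hol eq])
qed

section \<open>The Fejer kernel\<close>

text \<open>The Fourier transform of the tent function \<open>1 - |t| / T\<close> on
  \<open>[-T, T]\<close>, folded onto \<open>[0, T]\<close> by symmetry. For
  \<open>u \<noteq> 0\<close> it equals \<open>T (sin (T u / 2) / (T u / 2))^2\<close>.\<close>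

definition fejer_kernel :: "real \<Rightarrow> real \<Rightarrow> real" where
  "fejer_kernel T u = 2 * integral {0..T} (\<lambda>t. (1 - t / T) * cos (t * u))"

lemma fejer_kernel_le:
  assumes "T > 0"
  shows "fejer_kernel T u \<le> 2 * T"
proof -
  have "norm (integral {0..T} (\<lambda>t. (1 - t / T) * cos (t * u))) \<le> 1 * (T - 0)"
  proof (rule integral_bound)
    show "norm ((1 - t / T) * cos (t * u)) \<le> 1" if "t \<in> {0..T}" for t
    proof -
      have "\<bar>1 - t / T\<bar> * \<bar>cos (t * u)\<bar> \<le> 1 * 1"
        using that assms by (intro mult_mono) (auto simp: field_simps)
      then show ?thesis by (simp add: abs_mult)
    qed
  qed (use assms in \<open>auto intro!: continuous_intros\<close>)
  then show ?thesis by (simp add: fejer_kernel_def)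
qed

lemma has_integral_linear_weight:
  fixes T :: real
  assumes "T > 0"
  shows "((\<lambda>t. 1 - t / T) has_integral T / 2) {0..T}"
proof -
  have "((\<lambda>t. 1 - t / T) has_integral (T - T\<^sup>2 / (2 * T)) - (0 - 0\<^sup>2 / (2 * T))) {0..T}"
    by (rule fundamental_theorem_of_calculus)
       (use assms in \<open>auto intro!: derivative_eq_intros simp flip: has_real_derivative_iff_has_vector_derivative simp: field_simps\<close>)
  then show ?thesis using assms by (simp add: power2_eq_square)
qed

lemma fejer_kernel_eq:
  assumes "T > 0" "u \<noteq> 0"
  shows "fejer_kernel T u = 2 * (1 - cos (T * u)) / (T * u\<^sup>2)"
proof -
  have "((\<lambda>t. (1 - t / T) * cos (t * u)) has_integral
     ((1 - T / T) * sin (T * u) / u - cos (T * u) / (T * u\<^sup>2)) - ((1 - 0 / T) * sin (0 * u) / u - cos (0 * u) / (T * u\<^sup>2))) {0..T}"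
    by (rule fundamental_theorem_of_calculus)
       (use assms in \<open>auto intro!: derivative_eq_intros simp flip: has_real_derivative_iff_has_vector_derivative
          simp: field_simps power2_eq_square\<close>)
  then have "integral {0..T} (\<lambda>t. (1 - t / T) * cos (t * u)) = 1 / (T * u\<^sup>2) - cos (T * u) / (T * u\<^sup>2)"
    using assms by (simp add: integral_unique)
  then show ?thesis by (simp add: fejer_kernel_def diff_divide_distrib)
qed

lemma fejer_kernel_nonneg:
  assumes "T > 0"
  shows "fejer_kernel T u \<ge> 0"
proof (cases "u = 0")
  case True
  then show ?thesis using has_integral_linear_weight[OF assms] assms
    by (simp add: fejer_kernel_def integral_unique)
next
  case False
  then show ?thesis using assms by (simp add: fejer_kernel_eq)
qed

text \<open>This is one half of the concentration of the kernel: it is of order \<open>T\<close> for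
  \<open>|u| <= 1 / T\<close>, but at most of order \<open>1 / T\<close> at a fixed distance from
  zero.\<close>

lemma fejer_kernel_decay:
  assumes "T > 0"
  shows "u\<^sup>2 * fejer_kernel T u \<le> 4 / T"
proof (cases "u = 0")
  case False
  then have "u\<^sup>2 * fejer_kernel T u = 2 * (1 - cos (T * u)) / T"
    using assms by (simp add: fejer_kernel_eq)
  also have "\<dots> \<le> 4 / T"
    using assms cos_ge_minus_one[of "T * u"] by (intro divide_right_mono) (auto simp del: cos_ge_minus_one)
  finally show ?thesis .
qed (use assms in auto)

text \<open>The phase \<open>t * u\<close> is at most \<open>1 < pi / 3\<close> in absolute value
  throughout the range of integration, so the cosine is at least \<open>1 / 2\<close> and nothing
  cancels.\<close>

lemma fejer_kernel_ge:
  assumes "T > 0" "\<bar>T * u\<bar> \<le> 1"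
  shows "fejer_kernel T u \<ge> T / 2"
proof -
  have "T / 2 * (1 / 2) \<le> integral {0..T} (\<lambda>t. (1 - t / T) * cos (t * u))"
  proof (rule has_integral_le)
    show "((\<lambda>t. (1 - t / T) * (1 / 2)) has_integral T / 2 * (1 / 2)) {0..T}"
      by (rule has_integral_mult_left[OF has_integral_linear_weight[OF assms(1)]])
    show "((\<lambda>t. (1 - t / T) * cos (t * u)) has_integral integral {0..T} (\<lambda>t. (1 - t / T) * cos (t * u))) {0..T}"
      by (intro integrable_integral integrable_continuous_real continuous_intros) (use assms in auto)
    fix t assume t: "t \<in> {0..T}"
    have "\<bar>t * u\<bar> \<le> \<bar>T * u\<bar>" using t by (auto simp: abs_mult intro!: mult_right_mono)
    then have "\<bar>t * u\<bar> \<le> pi / 3" using assms(2) pi_gt3 by linarith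
    then have "cos (pi / 3) \<le> cos \<bar>t * u\<bar>" by (intro cos_monotone_0_pi_le) (use pi_gt_zero in auto)
    then have "1 / 2 \<le> cos (t * u)" by (simp add: cos_60 del: abs_mult)
    then show "(1 - t / T) * (1 / 2) \<le> (1 - t / T) * cos (t * u)"
      using t assms(1) by (intro mult_left_mono) auto
  qed
  then show ?thesis by (simp add: fejer_kernel_def)
qed

lemma norm_linear_weight_le:
  assumes "t \<in> {0..T}" "T > 0"
  shows "norm (complex_of_real (1 - t / T)) \<le> 1"
  using assms unfolding norm_of_real by (simp add: field_simps)

text \<open>One integration by parts gives Riemann--Lebesgue decay that is uniform in \<open>\<sigma>\<close>.\<close>

lemma fejer_integral_decay:
  fixes H :: "complex \<Rightarrow> complex"
  assumes U: "open U" "{s. Re s \<ge> 1} \<subseteq> U" and H: "H holomorphic_on U" and T: "T > 0"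
  obtains C where "C \<ge> 0" "\<And>y \<sigma>. y > 0 \<Longrightarrow> \<sigma> \<in> {1..2} \<Longrightarrow>
     norm (integral {0..T} (\<lambda>t. of_real (1 - t / T) * exp (\<i> * of_real (t * y)) * H (Complex \<sigma> t))) \<le> C / y"
proof -
  have dH: "deriv H holomorphic_on U" by (rule holomorphic_deriv[OF H U(1)])
  \<comment> \<open>A compact box containing the segments for all \<open>\<sigma>\<close> in
    \<open>[1, 2]\<close>; common bounds for \<open>H\<close> and its derivative on it make the
    estimate uniform in \<open>\<sigma>\<close>, up to the line \<open>Re s = 1\<close>.\<close>
  define K where "K = cbox (Complex 1 0) (Complex 2 T)"
  have K: "compact K" by (simp add: K_def)
  have KU: "K \<subseteq> U" using U(2) by (auto simp: K_def in_cbox_complex_iff)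
  have "bounded (H ` K)" "bounded (deriv H ` K)"
    using K KU H dH
    by (auto intro!: compact_imp_bounded compact_continuous_image
        continuous_on_subset[OF holomorphic_on_imp_continuous_on])
  then obtain B1 B2 where "\<And>s. s \<in> K \<Longrightarrow> norm (H s) \<le> B1" "\<And>s. s \<in> K \<Longrightarrow> norm (deriv H s) \<le> B2"
    unfolding bounded_iff by blast
  note B12 = this
  define B where "B = max 0 (max B1 B2)"
  have B: "B \<ge> 0" "\<And>s. s \<in> K \<Longrightarrow> norm (H s) \<le> B" "\<And>s. s \<in> K \<Longrightarrow> norm (deriv H s) \<le> B"
    using B12 by (auto simp: B_def le_max_iff_disj)
  have main: "norm (integral {0..T} (\<lambda>t. of_real (1 - t / T) * exp (\<i> * of_real (t * y)) * H (Complex \<sigma> t))) \<le> (3 * B + B * T) / y"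
    if y: "y > 0" and \<sigma>: "\<sigma> \<in> {1..2}" for y \<sigma>
  proof -
    define G where "G t = of_real (1 - t / T) * H (Complex \<sigma> t)" for t
    define G' where "G' t = of_real (- 1 / T) * H (Complex \<sigma> t) + of_real (1 - t / T) * (\<i> * deriv H (Complex \<sigma> t))" for t
    define E where "E t = exp (\<i> * of_real (t * y))" for t
    have inK: "Complex \<sigma> t \<in> K" if "t \<in> {0..T}" for t
      using that \<sigma> by (auto simp: K_def in_cbox_complex_iff)
    have Ceq: "Complex \<sigma> t = of_real \<sigma> + \<i> * of_real t" for t by (simp add: complex_eq_iff)
    have dG: "(G has_vector_derivative G' t) (at t within {0..T})" if t: "t \<in> {0..T}" for t
    proof -
      have "((\<lambda>t. Complex \<sigma> t) has_vector_derivative \<i>) (at t within {0..T})"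
        unfolding Ceq by (auto intro!: derivative_eq_intros)
      moreover have "(H has_field_derivative deriv H (Complex \<sigma> t)) (at (Complex \<sigma> t))"
        using holomorphic_derivI[OF H U(1)] inK[OF t] KU by auto
      ultimately have "((H \<circ> (\<lambda>t. Complex \<sigma> t)) has_vector_derivative \<i> * deriv H (Complex \<sigma> t)) (at t within {0..T})"
        by (rule field_vector_diff_chain_within[OF _ has_field_derivative_at_within])
      then have "((\<lambda>t. H (Complex \<sigma> t)) has_vector_derivative \<i> * deriv H (Complex \<sigma> t)) (at t within {0..T})"
        by (simp add: o_def)
      moreover have "((\<lambda>t. complex_of_real (1 - t / T)) has_vector_derivative of_real (- 1 / T)) (at t within {0..T})"
        by (rule has_vector_derivative_of_real) (use T in \<open>auto intro!: derivative_eq_intros\<close>)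
      ultimately show ?thesis unfolding G_def G'_def
        by (rule has_vector_derivative_eq_rhs[OF has_vector_derivative_mult[rotated]]) simp
    qed
    have dE: "(E has_vector_derivative \<i> * of_real y * E t) (at t within {0..T})" for t
    proof -
      have "((\<lambda>t. \<i> * of_real (t * y)) has_vector_derivative \<i> * of_real y) (at t within {0..T})"
        by (intro has_vector_derivative_mult_right has_vector_derivative_of_real) (auto intro!: derivative_eq_intros)
      from field_vector_diff_chain_within[OF this has_field_derivative_at_within[OF DERIV_exp]]
      show ?thesis unfolding E_def o_def .
    qed
    have cG: "continuous_on {0..T} G" "continuous_on {0..T} E" "continuous_on {0..T} G'"
    proof -
      show "continuous_on {0..T} G" using dG has_vector_derivative_continuous continuous_on_eq_continuous_within by blast
      show "continuous_on {0..T} E" using dE has_vector_derivative_continuous continuous_on_eq_continuous_within by blast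
      have c: "continuous_on {0..T} (\<lambda>t. Complex \<sigma> t)" unfolding Ceq by (intro continuous_intros)
      have "continuous_on {0..T} (\<lambda>t. H (Complex \<sigma> t))" "continuous_on {0..T} (\<lambda>t. deriv H (Complex \<sigma> t))"
        by (rule continuous_on_compose2[OF holomorphic_on_imp_continuous_on[OF H] c]
            continuous_on_compose2[OF holomorphic_on_imp_continuous_on[OF dH] c]; use inK KU in auto)+
      then show "continuous_on {0..T} G'" unfolding G'_def using T by (intro continuous_intros) auto
    qed
    \<comment> \<open>Integration by parts, written as the derivative of
      \<open>G * E / (i y)\<close>, where \<open>E' = i y E\<close>; the boundary terms and the
      remaining integral all carry the factor \<open>1 / y\<close>.\<close>
    have "((\<lambda>t. G t * E t + G' t * E t / (\<i> * of_real y)) has_integral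
        (G T * E T / (\<i> * of_real y) - G 0 * E 0 / (\<i> * of_real y))) {0..T}"
    proof (rule fundamental_theorem_of_calculus)
      fix t assume t: "t \<in> {0..T}"
      have "((\<lambda>t. G t * E t * (1 / (\<i> * of_real y))) has_vector_derivative
         (G t * (\<i> * of_real y * E t) + G' t * E t) * (1 / (\<i> * of_real y))) (at t within {0..T})"
        by (intro has_vector_derivative_mult_left has_vector_derivative_mult dG[OF t] dE)
      then show "((\<lambda>t. G t * E t / (\<i> * of_real y)) has_vector_derivative
         G t * E t + G' t * E t / (\<i> * of_real y)) (at t within {0..T})"
        using y by (simp add: field_simps)
    qed (use T in simp)
    moreover have i': "(\<lambda>t. G' t * E t / (\<i> * of_real y)) integrable_on {0..T}"
      by (intro integrable_continuous_real continuous_intros cG) (use y in auto)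
    moreover have "(\<lambda>t. G t * E t) integrable_on {0..T}"
      by (intro integrable_continuous_real continuous_intros cG)
    ultimately have eq: "integral {0..T} (\<lambda>t. G t * E t) = (G T * E T / (\<i> * of_real y) - G 0 * E 0 / (\<i> * of_real y))
        - integral {0..T} (\<lambda>t. G' t * E t / (\<i> * of_real y))"
      using integral_add[of "\<lambda>t. G t * E t" "{0..T}" "\<lambda>t. G' t * E t / (\<i> * of_real y)"]
      by (simp add: integral_unique algebra_simps)
    have nG: "norm (G t) \<le> B" if t: "t \<in> {0..T}" for t
    proof -
      have "norm (G t) \<le> 1 * B" unfolding G_def norm_mult
        using t T B inK norm_linear_weight_le[OF t T] by (intro mult_mono) auto
      then show ?thesis by simp
    qed
    have nG': "norm (G' t) \<le> B / T + B" if t: "t \<in> {0..T}" for t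
    proof -
      have "norm (of_real (- 1 / T) * H (Complex \<sigma> t)) \<le> (1 / T) * B" unfolding norm_mult
        using t T B inK by (intro mult_mono) (auto simp: norm_divide)
      moreover have "norm (of_real (1 - t / T) * (\<i> * deriv H (Complex \<sigma> t))) \<le> 1 * B" unfolding norm_mult[of "of_real _"]
        using t T B inK norm_linear_weight_le[OF t T] by (intro mult_mono) (auto simp: norm_mult)
      ultimately show ?thesis unfolding G'_def by (intro order.trans[OF norm_triangle_ineq]) simp
    qed
    have nE: "norm (E t) = 1" for t unfolding E_def by simp
    have "norm (integral {0..T} (\<lambda>t. G' t * E t / (\<i> * of_real y))) \<le> ((B / T + B) / y) * (T - 0)"
      by (intro integral_bound continuous_intros cG)
         (use T y nG' in \<open>auto simp: norm_mult norm_divide nE intro!: divide_right_mono\<close>)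
    moreover have "norm (G T * E T / (\<i> * of_real y)) \<le> B / y" "norm (G 0 * E 0 / (\<i> * of_real y)) \<le> B / y"
      using nG[of T] nG[of 0] T y by (auto simp: norm_mult norm_divide nE intro!: divide_right_mono)
    ultimately have "norm (integral {0..T} (\<lambda>t. G t * E t)) \<le> B / y + B / y + ((B / T + B) / y) * T"
      unfolding eq by (smt (verit) norm_triangle_ineq4)
    also have "\<dots> = (3 * B + B * T) / y" using T y by (simp add: field_simps)
    finally show ?thesis unfolding G_def E_def by (simp add: mult_ac)
  qed
  show ?thesis by (rule that[of "3 * B + B * T"]) (use B(1) T main in auto)
qed

text \<open>Inserting the series and integrating term by term is justified by uniform convergence on
  the segment, as \<open>\<sigma> > 1\<close>. The factor \<open>n^(-i t) e^(i t y)\<close> has real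
  part \<open>cos (t (ln n - y))\<close>, whose weighted integral is half of the kernel.\<close>

lemma dirichlet_fejer_sums:
  assumes a: "\<And>n. \<bar>a n\<bar> \<le> 1 + \<bar>ln (real n)\<bar>" and \<sigma>: "\<sigma> > 1" and T: "T > 0"
  shows "(\<lambda>n. a n * real n powr (-\<sigma>) * fejer_kernel T (ln (real n) - y)) sums
    (2 * Re (integral {0..T} (\<lambda>t. of_real (1 - t / T) * exp (\<i> * of_real (t * y)) * dirichlet_series a (Complex \<sigma> t))))"
proof -
  define w where "w t = of_real (1 - t / T) * exp (\<i> * of_real (t * y))" for t
  define f where "f n t = w t * (of_real (a n) * of_nat n powr (- Complex \<sigma> t))" for n t
  have nw: "norm (w t) \<le> 1" if "t \<in> {0..T}" for t
    using norm_linear_weight_le[OF that T] unfolding w_def norm_mult norm_exp_i_times by simp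
  have "uniform_limit {0..T} (\<lambda>N t. \<Sum>n<N. f n t) (\<lambda>t. \<Sum>n. f n t) sequentially"
  proof (rule Weierstrass_m_test)
    show "norm (f n t) \<le> (1 + \<bar>ln (real n)\<bar>) * real n powr (-\<sigma>)" if "t \<in> {0..T}" for n t
    proof -
      have "norm (f n t) \<le> 1 * ((1 + \<bar>ln (real n)\<bar>) * real n powr (-\<sigma>))"
        unfolding f_def norm_mult[of "w t"]
        by (intro mult_mono nw[OF that] dirichlet_term_le[OF a]) auto
      then show ?thesis by simp
    qed
    show "summable (\<lambda>n. (1 + \<bar>ln (real n)\<bar>) * real n powr (-\<sigma>))"
      by (rule summable_dirichlet_majorant[OF \<sigma>])
  qed
  moreover have "(\<Sum>n. f n t) = w t * dirichlet_series a (Complex \<sigma> t)" for t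
    unfolding f_def dirichlet_series_def
    by (rule suminf_mult) (use summable_norm_cancel[OF summable_norm_dirichlet[OF a, of "Complex \<sigma> t"]] \<sigma> in simp)
  ultimately have ul: "uniform_limit {0..T} (\<lambda>N t. \<Sum>n<N. f n t) (\<lambda>t. w t * dirichlet_series a (Complex \<sigma> t)) sequentially"
    by simp
  have Ceq: "Complex \<sigma> t = of_real \<sigma> + \<i> * of_real t" for t by (simp add: complex_eq_iff)
  have cf: "continuous_on {0..T} (f n)" for n
  proof (cases "n = 0")
    case False
    then show ?thesis unfolding f_def w_def Ceq using T by (intro continuous_intros) auto
  qed (simp add: f_def)
  obtain I J where IJ: "\<And>N. ((\<lambda>t. \<Sum>n<N. f n t) has_integral I N) {0..T}"
    "((\<lambda>t. w t * dirichlet_series a (Complex \<sigma> t)) has_integral J) {0..T}" "I \<longlonglongrightarrow> J"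
    using uniform_limit_integral[OF ul _ sequentially_bot] cf by (auto intro!: continuous_intros)
  have Ref: "Re (f n t) = a n * real n powr (-\<sigma>) * ((1 - t / T) * cos (t * (ln (real n) - y)))" for n t
  proof (cases "n = 0")
    case False
    have "exp (\<i> * of_real (t * y)) * of_nat n powr (- Complex \<sigma> t)
       = of_real (real n powr (-\<sigma>)) * exp (\<i> * of_real (t * (y - ln (real n))))"
      using False by (simp add: powr_def Ln_of_nat Ceq algebra_simps flip: exp_of_real exp_add)
    then have "f n t = of_real ((1 - t / T) * a n * real n powr (-\<sigma>)) * exp (\<i> * of_real (t * (y - ln (real n))))"
      unfolding f_def w_def by (simp add: mult_ac)
    also have "Re \<dots> = (1 - t / T) * a n * real n powr (-\<sigma>) * cos (t * (y - ln (real n)))"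
      by (simp only: times_complex.sel Re_complex_of_real Im_complex_of_real) (simp add: Re_exp)
    also have "cos (t * (y - ln (real n))) = cos (t * (ln (real n) - y))"
      using cos_minus[of "t * (ln (real n) - y)"] by (simp add: algebra_simps)
    finally show ?thesis by (simp add: mult_ac)
  qed (simp add: f_def)
  have "2 * Re (I N) = (\<Sum>n<N. a n * real n powr (-\<sigma>) * fejer_kernel T (ln (real n) - y))" for N
  proof -
    have "((\<lambda>t. Re (\<Sum>n<N. f n t)) has_integral Re (I N)) {0..T}"
      using has_integral_linear[OF IJ(1) bounded_linear_Re] by (simp add: o_def)
    moreover have "((\<lambda>t. Re (\<Sum>n<N. f n t)) has_integral
       (\<Sum>n<N. a n * real n powr (-\<sigma>) * integral {0..T} (\<lambda>t. (1 - t / T) * cos (t * (ln (real n) - y))))) {0..T}"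
      unfolding Re_sum Ref
      by (intro has_integral_sum has_integral_mult_right integrable_integral integrable_continuous_real continuous_intros)
         (use T in auto)
    ultimately have "Re (I N) = (\<Sum>n<N. a n * real n powr (-\<sigma>) * integral {0..T} (\<lambda>t. (1 - t / T) * cos (t * (ln (real n) - y))))"
      by (rule has_integral_unique)
    then show ?thesis by (simp add: fejer_kernel_def sum_distrib_left mult_ac)
  qed
  moreover have "(\<lambda>N. 2 * Re (I N)) \<longlonglongrightarrow> 2 * Re J"
    by (intro tendsto_intros IJ)
  moreover have "J = integral {0..T} (\<lambda>t. w t * dirichlet_series a (Complex \<sigma> t))"
    using IJ(2) by (simp add: integral_unique)
  ultimately show ?thesis unfolding sums_def w_def by simp
qed

section \<open>Primes in short intervals\<close>

definition log_bin :: "nat \<Rightarrow> nat set" where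
  "log_bin k = {n. n > 0 \<and> real k \<le> ln (real n) \<and> ln (real n) < real k + 1}"

lemma finite_log_le: "finite {n::nat. ln (real n) \<le> x}"
proof (rule finite_subset)
  show "{n::nat. ln (real n) \<le> x} \<subseteq> {..nat \<lceil>exp x\<rceil>}"
  proof clarify
    fix n :: nat assume *: "ln (real n) \<le> x"
    show "n \<le> nat \<lceil>exp x\<rceil>"
    proof (cases "n = 0")
      case False
      then have "real n \<le> exp x" using * by (metis exp_le_cancel_iff exp_ln of_nat_0_less_iff gr0I)
      then show ?thesis by linarith
    qed auto
  qed
qed auto

lemma finite_log_bin: "finite (log_bin k)"
  by (rule finite_subset[OF _ finite_log_le[of "real k + 1"]]) (auto simp: log_bin_def)

text \<open>A bin is so short that the weight on it is controlled, up to a factor 3, by the distance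
  \<open>j\<close> between the bin and the integer part of \<open>y\<close>. Such a bin contributes
  at most \<open>3 C / (1 + j^2)\<close>, every distance occurs at most twice, and the sum over
  \<open>j\<close> converges. The closed formula records that \<open>M\<close> depends on none of
  \<open>a\<close>, \<open>C\<close>, \<open>y\<close> and \<open>F\<close>.\<close>

lemma sum_log_bins_le:
  "\<exists>M>0. \<forall>(a :: nat \<Rightarrow> real) C y F. (\<forall>n. a n \<ge> 0) \<longrightarrow> (\<forall>k. (\<Sum>n\<in>log_bin k. a n) \<le> C) \<longrightarrow>
    y \<ge> 0 \<longrightarrow> finite F \<longrightarrow> 0 \<notin> F \<longrightarrow> (\<Sum>n\<in>F. a n / (1 + (ln (real n) - y)\<^sup>2)) \<le> M * C"
proof -
  define g where "g j = 1 / (1 + (real j)\<^sup>2)" for j :: nat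
  have g0: "g j > 0" for j by (simp add: g_def add_pos_nonneg)
  have sg: "summable g"
  proof (rule summable_comparison_test'[where N = 1])
    show "summable (\<lambda>n. real n powr (-2))" by (simp add: summable_real_powr_iff)
    show "norm (g n) \<le> real n powr (-2)" if "n \<ge> 1" for n
      using that by (simp add: g_def powr_minus powr_numeral divide_inverse add_pos_nonneg le_imp_inverse_le)
  qed
  define S where "S = suminf g"
  have S: "sum g A \<le> S" if "finite A" for A
    unfolding S_def using sum_le_suminf[OF sg that] g0 less_imp_le by blast
  have "S > 0" using S[of "{0}"] g0[of 0] by simp
  have "(\<Sum>n\<in>F. a n / (1 + (ln (real n) - y)\<^sup>2)) \<le> (6 * S) * C"
    if a: "\<And>n. a n \<ge> (0::real)" and C: "\<And>k. (\<Sum>n\<in>log_bin k. a n) \<le> C"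
      and y: "y \<ge> 0" and F: "finite F" "0 \<notin> F" for a C y F
  proof -
    have C0: "C \<ge> 0" using C[of 0] sum_nonneg[of "log_bin 0" a] a by (meson order_trans)
    define bin where "bin n = nat \<lfloor>ln (real n)\<rfloor>" for n :: nat
    define Y where "Y = nat \<lfloor>y\<rfloor>"
    define d where "d k = (if k \<ge> Y then k - Y else Y - k)" for k
    have bin: "real (bin n) \<le> ln (real n) \<and> ln (real n) < real (bin n) + 1" if "n \<in> F" for n
    proof -
      have "n \<ge> 1" using that F(2) by (cases n) auto
      then have "ln (real n) \<ge> 0" by simp
      then show ?thesis unfolding bin_def by linarith
    qed
    have Y: "real Y \<le> y" "y < real Y + 1" using y unfolding Y_def by linarith+
    have dd: "(real (d k))\<^sup>2 = (real k - real Y)\<^sup>2" for k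
      by (auto simp: d_def of_nat_diff power2_commute)
    \<comment> \<open>Passing from \<open>ln n\<close> and \<open>y\<close> to their integer parts
      changes the difference by at most 1, so \<open>v^2 <= 2 u^2 + 2\<close>; this is where the
      factor 3 comes from.\<close>
    have "(\<Sum>n\<in>F. a n / (1 + (ln (real n) - y)\<^sup>2)) \<le> (\<Sum>n\<in>F. 3 * g (d (bin n)) * a n)"
    proof (rule sum_mono)
      fix n assume n: "n \<in> F"
      define u where "u = ln (real n) - y"
      define v where "v = real (bin n) - real Y"
      define w where "w = v - u"
      have "\<bar>w\<bar> \<le> 1" using bin[OF n] Y unfolding u_def v_def w_def by linarith
      then have "w\<^sup>2 \<le> 1" by (simp add: abs_square_le_1)
      moreover have "v = u + w" by (simp add: w_def)
      then have "v\<^sup>2 \<le> 2 * u\<^sup>2 + 2 * w\<^sup>2"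
        using sum_squares_bound[of u w] by (simp add: power2_eq_square algebra_simps)
      moreover have "u\<^sup>2 \<ge> 0" by simp
      ultimately have "1 + v\<^sup>2 \<le> 3 * (1 + u\<^sup>2)" unfolding distrib_left by linarith
      then have "1 / (1 + u\<^sup>2) \<le> 3 / (1 + v\<^sup>2)"
        by (simp add: divide_simps add_pos_nonneg)
      then have "a n * (1 / (1 + u\<^sup>2)) \<le> a n * (3 / (1 + v\<^sup>2))"
        using a by (rule mult_left_mono)
      then show "a n / (1 + (ln (real n) - y)\<^sup>2) \<le> 3 * g (d (bin n)) * a n"
        unfolding g_def dd by (simp add: u_def v_def mult.commute)
    qed
    also have "\<dots> = (\<Sum>k\<in>bin ` F. \<Sum>n\<in>{n\<in>F. bin n = k}. 3 * g (d (bin n)) * a n)"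
      by (rule sum.image_gen[OF F(1)])
    also have "\<dots> = (\<Sum>k\<in>bin ` F. 3 * g (d k) * (\<Sum>n\<in>{n\<in>F. bin n = k}. a n))"
      by (simp add: sum_distrib_left)
    also have "\<dots> \<le> (\<Sum>k\<in>bin ` F. 3 * g (d k) * C)"
    proof (intro sum_mono mult_left_mono)
      fix k
      have "(\<Sum>n\<in>{n\<in>F. bin n = k}. a n) \<le> (\<Sum>n\<in>log_bin k. a n)"
        using a bin F(2) by (intro sum_mono2 finite_log_bin) (auto simp: log_bin_def intro!: Nat.gr0I)
      then show "(\<Sum>n\<in>{n\<in>F. bin n = k}. a n) \<le> C" using C order_trans by blast
      show "0 \<le> 3 * g (d k)" using g0[of "d k"] by simp
    qed
    also have "\<dots> = 3 * C * (\<Sum>k\<in>bin ` F. g (d k))"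
      by (simp add: sum_distrib_left mult_ac)
    also have "\<dots> \<le> 3 * C * (S + S)"
    proof (rule mult_left_mono)
      have "(\<Sum>k\<in>bin ` F. g (d k)) = (\<Sum>k\<in>bin ` F \<inter> {Y..}. g (d k)) + (\<Sum>k\<in>bin ` F - {Y..}. g (d k))"
        using F(1) by (intro sum.Int_Diff) auto
      also have "(\<Sum>k\<in>bin ` F \<inter> {Y..}. g (d k)) = sum g (d ` (bin ` F \<inter> {Y..}))"
        by (subst sum.reindex) (auto simp: inj_on_def d_def)
      also have "(\<Sum>k\<in>bin ` F - {Y..}. g (d k)) = sum g (d ` (bin ` F - {Y..}))"
        by (subst sum.reindex) (auto simp: inj_on_def d_def)
      also have "sum g (d ` (bin ` F \<inter> {Y..})) + sum g (d ` (bin ` F - {Y..})) \<le> S + S"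
        using F(1) by (intro add_mono S) auto
      finally show "(\<Sum>k\<in>bin ` F. g (d k)) \<le> S + S" .
    qed (use C0 in simp)
    finally show ?thesis by (simp add: mult_ac)
  qed
  then show ?thesis using \<open>S > 0\<close> by (intro exI[of _ "6 * S"]) simp
qed

lemma sum_inverse_log_bin: "(\<Sum>n\<in>log_bin k. 1 / real n) \<le> 3"
proof -
  have n: "exp (real k) \<le> real n \<and> real n < exp (real k + 1) \<and> n > 0" if "n \<in> log_bin k" for n
    using that unfolding log_bin_def
    by (metis (mono_tags, lifting) exp_le_cancel_iff exp_less_cancel_iff exp_ln mem_Collect_eq of_nat_0_less_iff)
  have "(\<Sum>n\<in>log_bin k. 1 / real n) \<le> (\<Sum>n\<in>log_bin k. 1 / exp (real k))"
    using n by (intro sum_mono divide_left_mono) auto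
  also have "\<dots> = real (card (log_bin k)) / exp (real k)" by simp
  also have "real (card (log_bin k)) \<le> exp (real k + 1)"
  proof -
    have "log_bin k \<subseteq> {1..nat \<lfloor>exp (real k + 1)\<rfloor>}"
    proof
      fix m assume "m \<in> log_bin k"
      from n[OF this] show "m \<in> {1..nat \<lfloor>exp (real k + 1)\<rfloor>}" by (simp add: le_nat_floor less_imp_le Suc_le_eq)
    qed
    then have "card (log_bin k) \<le> nat \<lfloor>exp (real k + 1)\<rfloor>"
      using card_mono[of "{1..nat \<lfloor>exp (real k + 1)\<rfloor>}"] by fastforce
    moreover have "real (nat \<lfloor>exp (real k + 1)\<rfloor>) \<le> exp (real k + 1)" by simp
    ultimately show ?thesis by linarith
  qed
  then have "real (card (log_bin k)) / exp (real k) \<le> exp (real k + 1) / exp (real k)"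
    by (intro divide_right_mono) auto
  also have "\<dots> = exp 1" by (simp add: exp_add)
  also have "\<dots> \<le> 3" by (rule exp_le)
  finally show ?thesis .
qed

text \<open>The weight \<open>n\<^sup>-\<^sup>1\<^sup>-\<^sup>1\<^sup>/\<^sup>y\<close> is comparable to \<open>1 / n\<close> as long as \<open>ln n = O(y)\<close>, and taking the
  abscissa \<open>1 + 1 / y\<close> makes all series converge.\<close>

definition smoothed_sum :: "(nat \<Rightarrow> real) \<Rightarrow> real \<Rightarrow> real \<Rightarrow> real" where
  "smoothed_sum a T y = (\<Sum>n. a n * real n powr (- (1 + 1 / y)) * fejer_kernel T (ln (real n) - y))"

lemma smoothed_sum_sums:
  assumes "\<And>n. \<bar>a n\<bar> \<le> 1 + \<bar>ln (real n)\<bar>" "T > 0" "y > 0"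
  shows "(\<lambda>n. a n * real n powr (- (1 + 1 / y)) * fejer_kernel T (ln (real n) - y)) sums smoothed_sum a T y"
  unfolding smoothed_sum_def
  by (intro summable_sums sums_summable[OF dirichlet_fejer_sums] assms) (use assms in auto)

text \<open>The abscissa \<open>1 + 1 / y\<close> moves towards 1 as \<open>y\<close> grows, which
  is why the decay had to be uniform in \<open>\<sigma>\<close>. The constant may depend on
  \<open>T\<close>, so \<open>T\<close> has to be fixed before \<open>y\<close> tends to
  infinity.\<close>

lemma smoothed_sum_mangoldt:
  assumes T: "T > 0"
  obtains C where "C \<ge> 0" "\<And>y. y \<ge> 1 \<Longrightarrow> \<bar>smoothed_sum mangoldt T y - smoothed_sum (\<lambda>_. 1) T y\<bar> \<le> C / y"
proof -
  obtain H U where U: "open U" "{s. Re s \<ge> 1} \<subseteq> U" "H holomorphic_on U"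
    "\<And>s. Re s > 1 \<Longrightarrow> H s = mangoldt_series s - zeta_series s"
    by (rule mangoldt_minus_zeta_continuation, rule that)
  obtain C where C: "C \<ge> 0" "\<And>y \<sigma>. y > 0 \<Longrightarrow> \<sigma> \<in> {1..2} \<Longrightarrow>
     norm (integral {0..T} (\<lambda>t. of_real (1 - t / T) * exp (\<i> * of_real (t * y)) * H (Complex \<sigma> t))) \<le> C / y"
    by (rule fejer_integral_decay[OF U(1-3) T], rule that)
  have "\<bar>smoothed_sum mangoldt T y - smoothed_sum (\<lambda>_. 1) T y\<bar> \<le> 2 * C / y" if y: "y \<ge> 1" for y
  proof -
    define \<sigma> where "\<sigma> = 1 + 1 / y"
    have \<sigma>: "\<sigma> > 1" "\<sigma> \<in> {1..2}" using y by (auto simp: \<sigma>_def)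
    define W where "W a t = of_real (1 - t / T) * exp (\<i> * of_real (t * y)) * dirichlet_series a (Complex \<sigma> t)" for a t
    have ex: "smoothed_sum a T y = 2 * Re (integral {0..T} (W a))"
      if "\<And>n. \<bar>a n\<bar> \<le> 1 + \<bar>ln (real n)\<bar>" for a
      using dirichlet_fejer_sums[OF that \<sigma>(1) T, of y]
      unfolding smoothed_sum_def W_def \<sigma>_def by (simp add: sums_iff)
    have cont: "W a integrable_on {0..T}" if a: "\<And>n. \<bar>a n\<bar> \<le> 1 + \<bar>ln (real n)\<bar>" for a
    proof -
      have Ceq: "Complex \<sigma> t = of_real \<sigma> + \<i> * of_real t" for t by (simp add: complex_eq_iff)
      have "continuous_on {s. Re s > 1} (dirichlet_series a)"
      proof (rule continuous_at_imp_continuous_on, rule ballI)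
        fix s :: complex assume "s \<in> {s. Re s > 1}"
        then obtain D where "(dirichlet_series a has_field_derivative D) (at s)"
          using dirichlet_series_derivative[OF a, of s] by auto
        then show "isCont (dirichlet_series a) s" by (rule DERIV_isCont)
      qed
      then have "continuous_on {0..T} (\<lambda>t. dirichlet_series a (Complex \<sigma> t))"
        by (rule continuous_on_compose2) (use \<sigma> in \<open>auto simp: Ceq intro!: continuous_intros\<close>)
      then show ?thesis unfolding W_def using T
        by (intro integrable_continuous_real continuous_intros) auto
    qed
    have "integral {0..T} (W mangoldt) - integral {0..T} (W (\<lambda>_. 1))
        = integral {0..T} (\<lambda>t. W mangoldt t - W (\<lambda>_. 1) t)"
      by (rule integral_diff[symmetric]) (intro cont mangoldt_bound one_bound)+
    also have "\<dots> = integral {0..T} (\<lambda>t. of_real (1 - t / T) * exp (\<i> * of_real (t * y)) * H (Complex \<sigma> t))"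
    proof -
      have "W mangoldt t - W (\<lambda>_. 1) t = of_real (1 - t / T) * exp (\<i> * of_real (t * y)) * H (Complex \<sigma> t)" for t
        unfolding W_def right_diff_distrib[symmetric] using U(4)[of "Complex \<sigma> t"] \<sigma>(1) by simp
      then show ?thesis by simp
    qed
    finally have "norm (integral {0..T} (W mangoldt) - integral {0..T} (W (\<lambda>_. 1))) \<le> C / y"
      using C(2)[of y \<sigma>] \<sigma> y by simp
    then have "\<bar>Re (integral {0..T} (W mangoldt) - integral {0..T} (W (\<lambda>_. 1)))\<bar> \<le> C / y"
      using abs_Re_le_cmod order_trans by blast
    then show ?thesis
      unfolding ex[OF mangoldt_bound] ex[OF one_bound] by (simp add: abs_if split: if_splits)
  qed
  then show ?thesis using C(1) by (intro that[of "2 * C"]) auto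
qed

lemma fejer_kernel_majorant:
  assumes "T > 0"
  shows "fejer_kernel T u \<le> (2 * T + 4 / T) / (1 + u\<^sup>2)"
proof -
  have "1 + u\<^sup>2 > 0" by (simp add: add_pos_nonneg)
  then show ?thesis
    using fejer_kernel_le[OF assms, of u] fejer_kernel_decay[OF assms, of u]
    by (subst pos_le_divide_eq) (simp_all add: distrib_left mult.commute)
qed

lemma powr_weight_le: "y > 0 \<Longrightarrow> real n powr (- (1 + 1 / y)) \<le> 1 / real n"
proof (cases "n = 0")
  case False
  assume "y > 0"
  then have "real n powr (- (1 + 1 / y)) \<le> real n powr (-1)"
    using False by (intro powr_mono) auto
  then show ?thesis using False by (simp add: powr_minus_divide)
qed auto

lemma powr_weight_ge:
  assumes "y \<ge> 1" "n > 0" "ln (real n) \<le> y + 1"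
  shows "exp (-2) / real n \<le> real n powr (- (1 + 1 / y))"
proof -
  have "- (1 + 1 / y) = - (1 / y) - 1" by simp
  then have "real n powr (- (1 + 1 / y)) = real n powr (- (1 / y) - 1)" by (simp only:)
  also have "\<dots> = real n powr (- (1 / y)) / real n" using assms by (simp add: powr_diff)
  also have "real n powr (- (1 / y)) = exp (- ln (real n) / y)" using assms by (simp add: powr_def)
  finally have "real n powr (- (1 + 1 / y)) = exp (- ln (real n) / y) / real n" .
  \<comment> \<open>Here \<open>ln n <= y + 1 <= 2 y\<close>, the origin of
    \<open>exp (-2)\<close>.\<close>
  moreover have "ln (real n) / y \<le> 2"
    using assms by (simp add: divide_simps)
  then have "exp (-2) \<le> exp (- ln (real n) / y)" by simp
  ultimately show ?thesis by (simp add: divide_right_mono)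
qed

text \<open>A bound of Chebyshev type, obtained from the comparison with the constant coefficient
  \<open>1\<close> for the fixed choice \<open>T = 1\<close>. It controls the prime powers far from
  the window, which a concentrated kernel still sees through its tail.\<close>

lemma mangoldt_log_bin_bound:
  obtains C where "C > 0" "\<And>k. (\<Sum>n\<in>log_bin k. mangoldt n / real n) \<le> C"
proof -
  obtain M :: real where M: "M > 0" and bins: "\<forall>(a :: nat \<Rightarrow> real) C y F. (\<forall>n. a n \<ge> 0) \<longrightarrow>
     (\<forall>k. (\<Sum>n\<in>log_bin k. a n) \<le> C) \<longrightarrow> y \<ge> 0 \<longrightarrow> finite F \<longrightarrow> 0 \<notin> F \<longrightarrow>
     (\<Sum>n\<in>F. a n / (1 + (ln (real n) - y)\<^sup>2)) \<le> M * C"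
    using sum_log_bins_le by blast
  obtain D where D: "D \<ge> 0" "\<And>y. y \<ge> 1 \<Longrightarrow> \<bar>smoothed_sum mangoldt 1 y - smoothed_sum (\<lambda>_. 1) 1 y\<bar> \<le> D / y"
    using smoothed_sum_mangoldt[of 1] by auto
  \<comment> \<open>The 6 is \<open>2 * T + 4 / T\<close> at \<open>T = 1\<close>, and the 3 bounds
    the sum of \<open>1 / n\<close> over a bin.\<close>
  have up: "smoothed_sum (\<lambda>_. 1) 1 y \<le> 6 * (M * 3)" if y: "y \<ge> 1" for y
  proof -
    have "smoothed_sum (\<lambda>_. 1) 1 y \<le> 6 * (M * 3)"
      unfolding smoothed_sum_def
    proof (rule suminf_le_const)
      show "summable (\<lambda>n. 1 * real n powr (- (1 + 1 / y)) * fejer_kernel 1 (ln (real n) - y))"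
        using sums_summable[OF smoothed_sum_sums[OF one_bound, of 1 y]] y by simp
      fix N
      have "(\<Sum>n<N. 1 * real n powr (- (1 + 1 / y)) * fejer_kernel 1 (ln (real n) - y))
        \<le> (\<Sum>n<N. if n = 0 then 0 else 6 * (1 / real n / (1 + (ln (real n) - y)\<^sup>2)))"
      proof (rule sum_mono)
        fix n
        have "real n powr (- (1 + 1 / y)) * fejer_kernel 1 (ln (real n) - y) \<le> 1 / real n * (6 / (1 + (ln (real n) - y)\<^sup>2))"
          using powr_weight_le[of y n] fejer_kernel_majorant[of 1 "ln (real n) - y"] fejer_kernel_nonneg[of 1] y
          by (intro mult_mono) auto
        then show "1 * real n powr (- (1 + 1 / y)) * fejer_kernel 1 (ln (real n) - y)
          \<le> (if n = 0 then 0 else 6 * (1 / real n / (1 + (ln (real n) - y)\<^sup>2)))"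
          by simp
      qed
      also have "\<dots> = 6 * (\<Sum>n\<in>{..<N} - {0}. 1 / real n / (1 + (ln (real n) - y)\<^sup>2))"
        unfolding sum_distrib_left by (rule sum.mono_neutral_cong_right) auto
      also have "\<dots> \<le> 6 * (M * 3)"
        using y by (intro mult_left_mono bins[rule_format] sum_inverse_log_bin) auto
      finally show "(\<Sum>n<N. 1 * real n powr (- (1 + 1 / y)) * fejer_kernel 1 (ln (real n) - y)) \<le> 6 * (M * 3)" .
    qed
    then show ?thesis .
  qed
  define C where "C = 2 * exp 2 * (6 * (M * 3) + D)"
  have "(\<Sum>n\<in>log_bin k. mangoldt n / real n) \<le> C" for k
  proof -
    \<comment> \<open>The right end of the bin: every \<open>n\<close> in it satisfies
      \<open>|ln n - y| <= 1\<close>, so the kernel is at least \<open>1 / 2\<close>, and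
      \<open>ln n <= y + 1\<close> as the weight bound needs.\<close>
    define y where "y = real k + 1"
    have y: "y \<ge> 1" by (simp add: y_def)
    have "(\<Sum>n\<in>log_bin k. exp (-2) / 2 * (mangoldt n / real n)) \<le>
       (\<Sum>n\<in>log_bin k. mangoldt n * real n powr (- (1 + 1 / y)) * fejer_kernel 1 (ln (real n) - y))"
    proof (rule sum_mono)
      fix n assume n: "n \<in> log_bin k"
      then have "exp (-2) / real n \<le> real n powr (- (1 + 1 / y))"
        by (intro powr_weight_ge) (auto simp: log_bin_def y_def)
      moreover have "1 / 2 \<le> fejer_kernel 1 (ln (real n) - y)"
        using fejer_kernel_ge[of 1 "ln (real n) - y"] n by (auto simp: log_bin_def y_def)
      ultimately have "exp (-2) / real n * (1 / 2) \<le> real n powr (- (1 + 1 / y)) * fejer_kernel 1 (ln (real n) - y)"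
        by (intro mult_mono) auto
      from mult_left_mono[OF this mangoldt_nonneg[of n]]
      show "exp (-2) / 2 * (mangoldt n / real n) \<le> mangoldt n * real n powr (- (1 + 1 / y)) * fejer_kernel 1 (ln (real n) - y)"
        by (simp add: mult_ac)
    qed
    also have "\<dots> \<le> smoothed_sum mangoldt 1 y"
      unfolding smoothed_sum_def
      using smoothed_sum_sums[OF mangoldt_bound, of 1 y] y
      by (intro sum_le_suminf finite_log_bin) (auto simp: sums_iff mangoldt_nonneg fejer_kernel_nonneg)
    also have "\<dots> \<le> 6 * (M * 3) + D / y"
      using D(2)[OF y] up[OF y] by linarith
    also have "D / y \<le> D" using D(1) y mult_left_mono[of 1 y D] by (simp add: divide_le_eq)
    finally have "exp (-2) / 2 * (\<Sum>n\<in>log_bin k. mangoldt n / real n) \<le> 6 * (M * 3) + D"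
      by (simp add: sum_distrib_left)
    then show ?thesis by (simp add: C_def exp_minus field_simps)
  qed
  moreover have "C > 0" using M D(1) by (simp add: C_def add_pos_nonneg)
  ultimately show ?thesis by (intro that)
qed

text \<open>The point is that the bound does not depend on \<open>T\<close>. Only the integers
  between \<open>e^(y - 1/T)\<close> and \<open>e^y\<close> are kept: there are at least
  \<open>e^y / (2 T) - 1\<close> of them, the kernel is at least \<open>T / 2\<close> there and the
  weight at least \<open>e^(-2 - y)\<close>. The condition on \<open>T\<close> and \<open>y\<close>
  makes the rounding loss at most half of the main term.\<close>

lemma smoothed_sum_one_lower:
  assumes T: "T \<ge> 1" and y: "y \<ge> 1" "4 * T * exp (-y) \<le> 1"
  shows "exp (-2) / 8 \<le> smoothed_sum (\<lambda>_. 1) T y"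
proof -
  define h where "h = 1 / T"
  have h: "h > 0" "h \<le> 1" using T by (auto simp: h_def)
  define I where "I = {nat \<lceil>exp (y - h)\<rceil>..nat \<lfloor>exp y\<rfloor>}"
  have I: "exp (y - h) \<le> real n \<and> real n \<le> exp y \<and> n > 0" if "n \<in> I" for n
  proof -
    have "nat \<lceil>exp (y - h)\<rceil> \<le> n" "n \<le> nat \<lfloor>exp y\<rfloor>" using that by (auto simp: I_def)
    then have *: "exp (y - h) \<le> real n" "real n \<le> exp y"
      using exp_gt_zero[of y] by linarith+
    moreover have "0 < real n" using less_le_trans[OF exp_gt_zero *(1)] .
    ultimately show ?thesis by simp
  qed
  have card: "exp y - exp (y - h) - 1 \<le> real (card I)"
  proof -
    have "exp y - 1 \<le> real (nat \<lfloor>exp y\<rfloor>)" by linarith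
    moreover have "real (nat \<lceil>exp (y - h)\<rceil>) \<le> exp (y - h) + 1"
      using exp_gt_zero[of "y - h"] by linarith
    moreover have "real a + 1 - real b \<le> real (card {b..a})" for a b :: nat
      unfolding card_atLeastAtMost by linarith
    ultimately show ?thesis unfolding I_def by (smt (verit))
  qed
  have "exp (-h) \<le> 1 - h / 2"
  proof -
    have "1 \<le> (1 - h / 2) * (1 + h)"
      using h mult_left_mono[of h 1 h] by (simp add: algebra_simps)
    also have "\<dots> \<le> (1 - h / 2) * exp h"
      using h exp_ge_add_one_self[of h] by (intro mult_left_mono) auto
    finally show ?thesis by (simp add: exp_minus field_simps)
  qed
  then have "exp y * (h / 2) - 1 \<le> exp y - exp y * exp (-h) - 1"
    using mult_left_mono[of "exp (-h)" "1 - h / 2" "exp y"] by (simp add: algebra_simps)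
  also have "exp y * exp (-h) = exp (y - h)" by (simp add: exp_diff exp_minus field_simps)
  also note card
  finally have c: "exp y * (h / 2) - 1 \<le> real (card I)" .
  have "1 / 8 \<le> T / 2 * (h / 2 - exp (-y))"
    using T y(2) by (simp add: h_def algebra_simps)
  from mult_left_mono[OF this, of "exp (-2)"]
  have "exp (-2) / 8 \<le> exp (-2) * (T / 2) * (h / 2 - exp (-y))" by simp
  also have "\<dots> = exp (-2) * exp (-y) * (T / 2) * (exp y * (h / 2) - 1)"
  proof -
    have "h / 2 - exp (-y) = exp (-y) * (exp y * (h / 2) - 1)"
      by (simp add: exp_minus right_diff_distrib)
    then show ?thesis by (simp only: mult_ac)
  qed
  also have "\<dots> \<le> exp (-2) * exp (-y) * (T / 2) * real (card I)"
    using c T by (intro mult_left_mono) auto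
  also have "\<dots> = (\<Sum>n\<in>I. exp (-2) * exp (-y) * (T / 2))" by simp
  also have "\<dots> \<le> (\<Sum>n\<in>I. 1 * real n powr (- (1 + 1 / y)) * fejer_kernel T (ln (real n) - y))"
  proof (rule sum_mono)
    fix n assume n: "n \<in> I"
    have ln: "y - h \<le> ln (real n)" "ln (real n) \<le> y"
      using I[OF n] by (metis exp_le_cancel_iff exp_ln of_nat_0_less_iff)+
    have "exp (-2) / exp y \<le> exp (-2) / real n"
      using I[OF n] by (intro divide_left_mono) auto
    also have "\<dots> \<le> real n powr (- (1 + 1 / y))"
      using I[OF n] ln y by (intro powr_weight_ge) auto
    finally have "exp (-2) * exp (-y) \<le> real n powr (- (1 + 1 / y))"
      by (simp add: exp_minus divide_inverse)
    moreover have "T / 2 \<le> fejer_kernel T (ln (real n) - y)"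
    proof (rule fejer_kernel_ge)
      have "\<bar>ln (real n) - y\<bar> \<le> h" using ln by linarith
      then have "T * \<bar>ln (real n) - y\<bar> \<le> T * h" using T by (intro mult_left_mono) auto
      then show "\<bar>T * (ln (real n) - y)\<bar> \<le> 1" using T by (simp add: abs_mult h_def)
    qed (use T in simp)
    ultimately show "exp (-2) * exp (-y) * (T / 2) \<le> 1 * real n powr (- (1 + 1 / y)) * fejer_kernel T (ln (real n) - y)"
      unfolding mult_1 using T by (intro mult_mono) auto
  qed
  also have "\<dots> \<le> smoothed_sum (\<lambda>_. 1) T y"
    unfolding smoothed_sum_def using smoothed_sum_sums[OF one_bound, of T y] T y
    by (intro sum_le_suminf) (auto simp: sums_iff fejer_kernel_nonneg I_def)
  finally show ?thesis .
qed

section \<open>Prime powers and primes in a logarithmic window\<close>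

definition log_window :: "real \<Rightarrow> real \<Rightarrow> nat set" where
  "log_window \<eta> y = {n. n > 0 \<and> \<bar>ln (real n) - y\<bar> \<le> \<eta>}"

lemma finite_log_window: "finite (log_window \<eta> y)"
  by (rule finite_subset[OF _ finite_log_le[of "y + \<eta>"]]) (auto simp: log_window_def)

text \<open>Inside the window the kernel is at most \<open>2 T\<close>. Outside it decays like
  \<open>1 / (T u^2)\<close>, and the bin bound makes this tail \<open>D / T\<close> uniformly in
  \<open>y\<close>, with \<open>D\<close> independent of \<open>T\<close>. The tail can thus be made
  smaller than the lower bound \<open>exp (-2) / 8\<close> by the choice of
  \<open>T\<close>.\<close>

lemma smoothed_sum_mangoldt_upper:
  assumes \<eta>: "0 < \<eta>" "\<eta> \<le> 1"
  obtains D where "D > 0" "\<And>T y. T > 0 \<Longrightarrow> y > 0 \<Longrightarrow>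
    smoothed_sum mangoldt T y \<le> 2 * T * (\<Sum>n\<in>log_window \<eta> y. mangoldt n / real n) + D / T"
proof -
  obtain M :: real where M: "M > 0" and bins: "\<forall>(a :: nat \<Rightarrow> real) C y F. (\<forall>n. a n \<ge> 0) \<longrightarrow>
     (\<forall>k. (\<Sum>n\<in>log_bin k. a n) \<le> C) \<longrightarrow> y \<ge> 0 \<longrightarrow> finite F \<longrightarrow> 0 \<notin> F \<longrightarrow>
     (\<Sum>n\<in>F. a n / (1 + (ln (real n) - y)\<^sup>2)) \<le> M * C"
    using sum_log_bins_le by blast
  obtain C where C: "C > 0" "\<And>k. (\<Sum>n\<in>log_bin k. mangoldt n / real n) \<le> C"
    by (rule mangoldt_log_bin_bound, rule that)
  define D where "D = 8 / \<eta>\<^sup>2 * (M * C)"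
  have "smoothed_sum mangoldt T y \<le> 2 * T * (\<Sum>n\<in>log_window \<eta> y. mangoldt n / real n) + D / T"
    if T: "T > 0" and y: "y > 0" for T y
    unfolding smoothed_sum_def
  proof (rule suminf_le_const)
    show "summable (\<lambda>n. mangoldt n * real n powr (- (1 + 1 / y)) * fejer_kernel T (ln (real n) - y))"
      using sums_summable[OF smoothed_sum_sums[OF mangoldt_bound, of T y]] y T by simp
    fix N
    let ?f = "\<lambda>n. mangoldt n * real n powr (- (1 + 1 / y)) * fejer_kernel T (ln (real n) - y)"
    let ?W = "log_window \<eta> y"
    have w: "?f n \<le> mangoldt n / real n * fejer_kernel T (ln (real n) - y)" for n
      using mult_left_mono[OF powr_weight_le[OF y, of n] mangoldt_nonneg[of n]] fejer_kernel_nonneg[OF T]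
      by (intro mult_right_mono) auto
    have "sum ?f {..<N} = sum ?f ({..<N} \<inter> ?W) + sum ?f ({..<N} - ?W)"
      by (rule sum.Int_Diff) simp
    also have "sum ?f ({..<N} \<inter> ?W) \<le> (\<Sum>n\<in>{..<N} \<inter> ?W. 2 * T * (mangoldt n / real n))"
    proof (rule sum_mono)
      fix n
      have "mangoldt n / real n * fejer_kernel T (ln (real n) - y) \<le> mangoldt n / real n * (2 * T)"
        using mangoldt_nonneg[of n] by (intro mult_left_mono fejer_kernel_le T) auto
      then show "?f n \<le> 2 * T * (mangoldt n / real n)" using w[of n] by (simp add: mult_ac)
    qed
    also have "\<dots> \<le> (\<Sum>n\<in>?W. 2 * T * (mangoldt n / real n))"
      using T by (intro sum_mono2 finite_log_window) (auto simp: mangoldt_nonneg)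
    also have "sum ?f ({..<N} - ?W) \<le> (\<Sum>n\<in>{..<N} - ?W - {0}. 8 / (T * \<eta>\<^sup>2) * (mangoldt n / real n / (1 + (ln (real n) - y)\<^sup>2)))"
    proof -
      have "sum ?f ({..<N} - ?W) = sum ?f ({..<N} - ?W - {0})"
        by (rule sum.mono_neutral_right) auto
      also have "\<dots> \<le> (\<Sum>n\<in>{..<N} - ?W - {0}. 8 / (T * \<eta>\<^sup>2) * (mangoldt n / real n / (1 + (ln (real n) - y)\<^sup>2)))"
      proof (rule sum_mono)
        fix n assume n: "n \<in> {..<N} - ?W - {0}"
        define u where "u = ln (real n) - y"
        have "\<eta> < \<bar>u\<bar>" using n by (auto simp: log_window_def u_def)
        then have u: "\<eta>\<^sup>2 \<le> u\<^sup>2" using \<eta>(1) by (metis abs_le_square_iff abs_of_pos less_imp_le)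
        have "\<eta>\<^sup>2 \<le> 1" using \<eta> by (simp add: power_le_one)
        \<comment> \<open>Outside the window \<open>1 + u^2\<close> is at most
          \<open>2 / \<eta>^2\<close> times \<open>u^2\<close>; with the kernel bound
          \<open>4 / T\<close> this gives the 8 in \<open>D\<close>.\<close>
        then have "\<eta>\<^sup>2 * (1 + u\<^sup>2) \<le> 2 * u\<^sup>2"
          using u mult_right_mono[of "\<eta>\<^sup>2" 1 "u\<^sup>2"] by (simp add: distrib_left)
        then have "\<eta>\<^sup>2 * (1 + u\<^sup>2) * fejer_kernel T u \<le> 2 * u\<^sup>2 * fejer_kernel T u"
          using fejer_kernel_nonneg[OF T] by (rule mult_right_mono)
        also have "\<dots> \<le> 2 * (4 / T)"
          using fejer_kernel_decay[OF T, of u] by simp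
        finally have "fejer_kernel T u \<le> 8 / (T * \<eta>\<^sup>2) / (1 + u\<^sup>2)"
          using T \<eta> by (simp add: divide_simps add_pos_nonneg mult_ac)
        then have "mangoldt n / real n * fejer_kernel T u \<le> mangoldt n / real n * (8 / (T * \<eta>\<^sup>2) / (1 + u\<^sup>2))"
          using mangoldt_nonneg[of n] by (intro mult_left_mono) auto
        then show "?f n \<le> 8 / (T * \<eta>\<^sup>2) * (mangoldt n / real n / (1 + (ln (real n) - y)\<^sup>2))"
          using w[of n] unfolding u_def by (simp add: mult_ac)
      qed
      finally show ?thesis .
    qed
    also have "(\<Sum>n\<in>{..<N} - ?W - {0}. 8 / (T * \<eta>\<^sup>2) * (mangoldt n / real n / (1 + (ln (real n) - y)\<^sup>2)))
        = 8 / (T * \<eta>\<^sup>2) * (\<Sum>n\<in>{..<N} - ?W - {0}. mangoldt n / real n / (1 + (ln (real n) - y)\<^sup>2))"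
      by (rule sum_distrib_left[symmetric])
    also have "\<dots> \<le> 8 / (T * \<eta>\<^sup>2) * (M * C)"
      using y T by (intro mult_left_mono bins[rule_format] C(2)) (auto simp: mangoldt_nonneg)
    also have "\<dots> = D / T" by (simp add: D_def)
    also have "(\<Sum>n\<in>?W. 2 * T * (mangoldt n / real n)) = 2 * T * (\<Sum>n\<in>?W. mangoldt n / real n)"
      by (rule sum_distrib_left[symmetric])
    finally show "sum ?f {..<N} \<le> 2 * T * (\<Sum>n\<in>?W. mangoldt n / real n) + D / T"
      by simp
  qed
  moreover have "D > 0" using M C(1) \<eta> by (simp add: D_def)
  ultimately show ?thesis by (intro that)
qed

lemma mangoldt_log_window_lower:
  assumes \<eta>: "0 < \<eta>" "\<eta> \<le> 1"
  obtains c where "c > 0" "\<forall>\<^sub>F y in at_top. c \<le> (\<Sum>n\<in>log_window \<eta> y. mangoldt n / real n)"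
proof -
  obtain D where D: "D > 0" "\<And>T y. T > 0 \<Longrightarrow> y > 0 \<Longrightarrow>
    smoothed_sum mangoldt T y \<le> 2 * T * (\<Sum>n\<in>log_window \<eta> y. mangoldt n / real n) + D / T"
    by (rule smoothed_sum_mangoldt_upper[OF \<eta>], rule that)
  \<comment> \<open>With this \<open>T\<close> the tail is at most a quarter of
    \<open>exp (-2) / 8\<close>; for large \<open>y\<close> the error \<open>C / y\<close> is below
    another quarter, and half of the main term is left.\<close>
  define T where "T = max 1 (32 * D * exp 2)"
  have T: "T \<ge> 1" "T > 0" by (auto simp: T_def)
  have "32 * D * exp 2 \<le> T" by (simp add: T_def)
  then have DT: "D / T \<le> exp (-2) / 32"
    using T by (simp add: exp_minus field_simps)
  obtain C where C: "C \<ge> 0" "\<And>y. y \<ge> 1 \<Longrightarrow> \<bar>smoothed_sum mangoldt T y - smoothed_sum (\<lambda>_. 1) T y\<bar> \<le> C / y"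
    by (rule smoothed_sum_mangoldt[OF T(2)], rule that)
  have "\<forall>\<^sub>F y in at_top. C / y < exp (-2) / 32"
  proof -
    have "((\<lambda>y. C / y) \<longlongrightarrow> 0) at_top" by real_asymp
    then show ?thesis by (rule order_tendstoD(2)) simp
  qed
  moreover have "\<forall>\<^sub>F y in at_top. 4 * T * exp (-y) < 1"
  proof -
    have "((\<lambda>y. 4 * T * exp (-y)) \<longlongrightarrow> 0) at_top" by real_asymp
    then show ?thesis by (rule order_tendstoD(2)) simp
  qed
  ultimately have "\<forall>\<^sub>F y in at_top. exp (-2) / 32 / T \<le> (\<Sum>n\<in>log_window \<eta> y. mangoldt n / real n)"
    using eventually_ge_at_top[of 1]
  proof eventually_elim
    case (elim y)
    have "exp (-2) / 8 \<le> smoothed_sum (\<lambda>_. 1) T y"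
      using elim T by (intro smoothed_sum_one_lower) auto
    then have "exp (-2) / 16 \<le> 2 * T * (\<Sum>n\<in>log_window \<eta> y. mangoldt n / real n)"
      using D(2)[of T y] C(2)[of y] elim T DT by linarith
    then show ?case using T by (simp add: field_simps)
  qed
  moreover have "exp (-2) / 32 / T > 0" using T by simp
  ultimately show ?thesis by (intro that)
qed

text \<open>An exponent of at least 2 forces the prime to be at most \<open>e^((y + 1) / 2)\<close>,
  and \<open>ln p >= 1 / 2\<close> bounds the exponent by \<open>2 (y + 1)\<close>. The number of
  such prime powers times the largest possible term is of order \<open>y^2 e^(-y / 2)\<close>, which
  tends to zero.\<close>

lemma composite_prime_powers_negligible:
  assumes \<eta>: "0 < \<eta>" "\<eta> \<le> 1" and y: "y \<ge> 1"
  shows "(\<Sum>n\<in>{n\<in>log_window \<eta> y. \<not> prime n}. mangoldt n / real n)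
    \<le> (exp ((y + 1) / 2) + 1) * (2 * (y + 1) + 1) * ((y + 1) * exp (1 - y))"
proof -
  let ?A = "{n\<in>log_window \<eta> y. \<not> prime n \<and> primepow n}"
  let ?P = "{..nat \<lfloor>exp ((y + 1) / 2)\<rfloor>} \<times> {..nat \<lfloor>2 * (y + 1)\<rfloor>}"
  have b: "exp (y - 1) \<le> real n \<and> real n \<le> exp (y + 1) \<and> n > 0 \<and> ln (real n) \<le> y + 1" if "n \<in> log_window \<eta> y" for n
  proof -
    have "n > 0" "y - 1 \<le> ln (real n)" "ln (real n) \<le> y + 1" using that \<eta> by (auto simp: log_window_def)
    moreover from this have "exp (y - 1) \<le> real n" "real n \<le> exp (y + 1)"
      by (metis exp_le_cancel_iff exp_ln of_nat_0_less_iff)+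
    ultimately show ?thesis by simp
  qed
  have sub: "?A \<subseteq> (\<lambda>(p, k). p ^ k) ` ?P"
  proof
    fix n assume n: "n \<in> ?A"
    then obtain p k where pk: "prime p" "k > 0" "n = p ^ k" by (auto simp: primepow_def)
    have "k \<noteq> 1" using n pk by auto
    then have k: "k \<ge> 2" using pk by simp
    have p: "p \<ge> 2" using pk prime_ge_2_nat by blast
    have ln: "real k * ln (real p) \<le> y + 1"
      using b[of n] n pk p by (auto simp: ln_realpow)
    have lnp: "ln (real p) \<ge> 1 / 2"
    proof -
      have "ln (real p) \<ge> ln 2" using p by simp
      then show ?thesis using ln2_ge_two_thirds by linarith
    qed
    have "2 * ln (real p) \<le> real k * ln (real p)" using k lnp by (intro mult_right_mono) auto
    then have "ln (real p) \<le> (y + 1) / 2" using ln by simp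
    then have "real p \<le> exp ((y + 1) / 2)"
      using p by (metis exp_le_cancel_iff exp_ln of_nat_0_less_iff pos2 less_le_trans)
    then have 1: "p \<le> nat \<lfloor>exp ((y + 1) / 2)\<rfloor>" by (simp add: le_nat_floor)
    have "real k * (1 / 2) \<le> real k * ln (real p)" using lnp by (intro mult_left_mono) auto
    then have "real k \<le> 2 * (y + 1)" using ln by simp
    then have 2: "k \<le> nat \<lfloor>2 * (y + 1)\<rfloor>" by (rule le_nat_floor)
    show "n \<in> (\<lambda>(p, k). p ^ k) ` ?P" using 1 2 pk(3) by (intro image_eqI[of _ _ "(p, k)"]) auto
  qed
  have "(\<Sum>n\<in>{n\<in>log_window \<eta> y. \<not> prime n}. mangoldt n / real n) = (\<Sum>n\<in>?A. mangoldt n / real n)"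
    by (rule sum.mono_neutral_right) (auto simp: finite_log_window mangoldt_def)
  also have "\<dots> \<le> (\<Sum>n\<in>?A. (y + 1) * exp (1 - y))"
  proof (rule sum_mono)
    fix n assume "n \<in> ?A"
    then have n: "exp (y - 1) \<le> real n" "n > 0" "ln (real n) \<le> y + 1" using b by auto
    have "mangoldt n / real n \<le> (y + 1) / exp (y - 1)"
      using n mangoldt_le[of n] y by (intro frac_le) auto
    also have "\<dots> = (y + 1) * exp (1 - y)"
      using exp_minus[of "y - 1"] by (simp add: divide_inverse)
    finally show "mangoldt n / real n \<le> (y + 1) * exp (1 - y)" .
  qed
  also have "\<dots> = real (card ?A) * ((y + 1) * exp (1 - y))" by simp
  also have "\<dots> \<le> ((exp ((y + 1) / 2) + 1) * (2 * (y + 1) + 1)) * ((y + 1) * exp (1 - y))"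
  proof (rule mult_right_mono)
    have "card ?A \<le> card ((\<lambda>(p, k). p ^ k) ` ?P)" by (rule card_mono[OF _ sub]) simp
    also have "\<dots> \<le> card ?P" by (rule card_image_le) simp
    also have "\<dots> = (nat \<lfloor>exp ((y + 1) / 2)\<rfloor> + 1) * (nat \<lfloor>2 * (y + 1)\<rfloor> + 1)"
      by (simp add: card_cartesian_product)
    finally have "real (card ?A) \<le> real (nat \<lfloor>exp ((y + 1) / 2)\<rfloor> + 1) * real (nat \<lfloor>2 * (y + 1)\<rfloor> + 1)"
      by (metis of_nat_le_iff of_nat_mult)
    also have "\<dots> \<le> (exp ((y + 1) / 2) + 1) * (2 * (y + 1) + 1)"
      using y by (intro mult_mono) auto
    finally show "real (card ?A) \<le> (exp ((y + 1) / 2) + 1) * (2 * (y + 1) + 1)" .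
  qed (use y in simp)
  finally show ?thesis .
qed

theorem eventually_prime_near:
  assumes "\<eta> > 0"
  shows "\<forall>\<^sub>F y in at_top. \<exists>p::nat. prime p \<and> \<bar>ln (real p) - y\<bar> \<le> \<eta>"
proof -
  define e where "e = min \<eta> 1"
  have e: "0 < e" "e \<le> 1" "e \<le> \<eta>" using assms by (auto simp: e_def)
  obtain c where c: "c > 0" "\<forall>\<^sub>F y in at_top. c \<le> (\<Sum>n\<in>log_window e y. mangoldt n / real n)"
    by (rule mangoldt_log_window_lower[OF e(1,2)], rule that)
  have "((\<lambda>y::real. (exp ((y + 1) / 2) + 1) * (2 * (y + 1) + 1) * ((y + 1) * exp (1 - y))) \<longlongrightarrow> 0) at_top"
    by real_asymp
  then have "\<forall>\<^sub>F y::real in at_top. (exp ((y + 1) / 2) + 1) * (2 * (y + 1) + 1) * ((y + 1) * exp (1 - y)) < c"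
    by (rule order_tendstoD(2)) (rule c(1))
  then show ?thesis using c(2) eventually_ge_at_top[of 1]
  proof eventually_elim
    case (elim y)
    have "\<exists>p\<in>log_window e y. prime p"
    proof (rule ccontr)
      assume "\<not> ?thesis"
      then have "log_window e y = {n\<in>log_window e y. \<not> prime n}" by auto
      then have "(\<Sum>n\<in>log_window e y. mangoldt n / real n) < c"
        using composite_prime_powers_negligible[OF e(1,2) elim(3)] elim(1) by simp
      then show False using elim(2) by simp
    qed
    then obtain p where "p \<in> log_window e y" "prime p" by blast
    then show ?case using e(3) by (intro exI[of _ p]) (simp add: log_window_def)
  qed
qed

section \<open>The theorem\<close>

text \<open>The ideal value of the prime is \<open>r n = sqrt (n / (t + 2))\<close>, for which the
  construction fills all \<open>n\<close> vertices. The window is centred at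
  \<open>ln (r n) - \<eta>\<close> rather than \<open>ln (r n)\<close>, so the prime never exceeds
  \<open>r n\<close> and loses at most a factor \<open>exp (- 2 * \<eta>)\<close>; the cube in the
  edge count turns this into \<open>exp (- 6 * \<eta>)\<close>.\<close>

lemma ex_number_asymptotic_lower:
  fixes t :: nat and \<eta> :: real
  assumes "\<eta> > 0" "t \<ge> 1"
  shows "\<forall>\<^sub>F n in sequentially. (real t + 1) / (2 * sqrt (real t + 2)) * exp (- 6 * \<eta>) * real n * sqrt (real n)
    \<le> real (ex_number n {triangle_graph, complete_bipartite 2 (2 * t + 1)})"
proof -
  define r where "r n = sqrt (real n / (real t + 2))" for n :: nat
  have "filterlim (\<lambda>n. ln (r n) - \<eta>) at_top sequentially"
    unfolding r_def by real_asymp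
  from eventually_compose_filterlim[OF eventually_prime_near[OF assms(1)] this]
  have "\<forall>\<^sub>F n in sequentially. \<exists>p::nat. prime p \<and> \<bar>ln (real p) - (ln (r n) - \<eta>)\<bar> \<le> \<eta>" .
  moreover have "filterlim (\<lambda>n. r n * exp (- 2 * \<eta>)) at_top sequentially"
    unfolding r_def by real_asymp
  then have "\<forall>\<^sub>F n in sequentially. real t + 2 < r n * exp (- 2 * \<eta>)"
    by (simp add: filterlim_at_top_dense)
  ultimately show ?thesis using eventually_gt_at_top[of 0]
  proof eventually_elim
    case (elim n)
    then obtain p :: nat where p: "prime p" "\<bar>ln (real p) - (ln (r n) - \<eta>)\<bar> \<le> \<eta>" by blast
    have r0: "r n > 0" using elim(3) by (simp add: r_def)
    have p0: "real p > 0" using prime_gt_0_nat[OF p(1)] by simp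
    have "ln (real p) \<le> ln (r n)" using p(2) by linarith
    then have pr: "real p \<le> r n" using p0 r0 by simp
    have "ln (r n) - 2 * \<eta> \<le> ln (real p)" using p(2) by linarith
    then have "exp (ln (r n) - 2 * \<eta>) \<le> real p" using p0 by (metis exp_le_cancel_iff exp_ln)
    then have rp: "r n * exp (- 2 * \<eta>) \<le> real p" using r0 by (simp add: exp_diff exp_minus field_simps)
    have rr: "(real t + 2) * (r n)\<^sup>2 = real n" by (simp add: r_def)
    have "(real t + 2) * (real p)\<^sup>2 \<le> (real t + 2) * (r n)\<^sup>2"
      using pr by (intro mult_left_mono power_mono) auto
    then have "real ((t + 2) * p\<^sup>2) \<le> real n" using rr by (simp add: algebra_simps)
    then have "(t + 2) * p\<^sup>2 \<le> n" by (simp only: of_nat_le_iff)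
    moreover have "real (t + 2) < real p" using elim(2) rp by simp
    then have "t + 2 < p" by (simp only: of_nat_less_iff)
    ultimately have "(t + 2) * (t + 1) * p ^ 3 \<le> 2 * ex_number n {triangle_graph, complete_bipartite 2 (2 * t + 1)}"
      using p(1) assms(2) by (intro ex_number_prime_ge) auto
    then have ex: "real ((t + 2) * (t + 1) * p ^ 3) \<le> real (2 * ex_number n {triangle_graph, complete_bipartite 2 (2 * t + 1)})"
      by (simp only: of_nat_le_iff)
    have "(r n * exp (- 2 * \<eta>)) ^ 3 \<le> real p ^ 3"
      using rp r0 by (intro power_mono) auto
    then have "(real t + 2) * (real t + 1) * (r n * exp (- 2 * \<eta>)) ^ 3 \<le> (real t + 2) * (real t + 1) * real p ^ 3"
      by (intro mult_left_mono) auto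
    also have "\<dots> = real ((t + 2) * (t + 1) * p ^ 3)" by (simp add: algebra_simps)
    also note ex
    also have "(real t + 2) * (real t + 1) * (r n * exp (- 2 * \<eta>)) ^ 3 = (real t + 1) * ((real t + 2) * (r n)\<^sup>2) * r n * exp (- 6 * \<eta>)"
      by (simp add: power_mult_distrib power2_eq_square power3_eq_cube exp_add[symmetric])
    also have "\<dots> = (real t + 1) * real n * (sqrt (real n) / sqrt (real t + 2)) * exp (- 6 * \<eta>)"
      unfolding rr by (simp add: r_def real_sqrt_divide)
    finally show ?case by (simp add: field_simps)
  qed
qed

theorem theorem1p7:
  fixes t :: nat
  assumes "t \<ge> 1"
  shows "liminf (\<lambda>n. ereal (real (ex_number n {triangle_graph, complete_bipartite 2 (2 * t + 1)})
                          / real (z_number n (complete_bipartite 2 (2 * t + 1)))))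
         \<ge> ereal ((real t + 1) / sqrt (real t * (real t + 2)))"
proof -
  define c where "c = (real t + 1) / sqrt (real t * (real t + 2))"
  define X where "X n = real (ex_number n {triangle_graph, complete_bipartite 2 (2 * t + 1)})" for n
  define Z where "Z n = real (z_number n (complete_bipartite 2 (2 * t + 1)))" for n
  have c: "c = (real t + 1) / sqrt (real t + 2) / sqrt (real t)"
    by (simp add: c_def real_sqrt_mult)
  have ev: "\<forall>\<^sub>F n in sequentially. d < X n / Z n" if d: "d < c" for d
  proof -
    have "((\<lambda>\<eta>. c * exp (- 6 * \<eta>)) \<longlongrightarrow> c * exp (- 6 * 0)) (at_right 0)"
      by (intro tendsto_intros)
    then have "\<forall>\<^sub>F \<eta> in at_right 0. d < c * exp (- 6 * \<eta>)"
      using d by (intro order_tendstoD(1)[of _ "c"]) simp_all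
    moreover have "\<forall>\<^sub>F \<eta>::real in at_right 0. 0 < \<eta>" by (rule eventually_at_right_less)
    ultimately obtain \<eta> :: real where \<eta>: "\<eta> > 0" "d < c * exp (- 6 * \<eta>)"
      using eventually_happens'[OF trivial_limit_at_right_real eventually_conj] by blast
    define K where "K = (real t + 1) / sqrt (real t + 2) * exp (- 6 * \<eta>)"
    \<comment> \<open>Both estimates are compared after division by \<open>n sqrt n / 2\<close>: the
      linear term \<open>n\<close> of the bound for the denominator becomes
      \<open>2 / sqrt n\<close> and disappears in the limit.\<close>
    have "((\<lambda>n. K / (2 / sqrt (real n) + sqrt (real t))) \<longlongrightarrow> K / (0 + sqrt (real t))) sequentially"
      using assms by (intro tendsto_intros real_tendsto_divide_at_top filterlim_compose[OF sqrt_at_top filterlim_real_sequentially]) auto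
    moreover have "d < K / (0 + sqrt (real t))" using \<eta>(2) by (simp add: K_def c)
    ultimately have "\<forall>\<^sub>F n in sequentially. d < K / (2 / sqrt (real n) + sqrt (real t))"
      by (rule order_tendstoD(1))
    then show ?thesis using ex_number_asymptotic_lower[OF \<eta>(1) assms] eventually_ge_at_top[of 2]
    proof eventually_elim
      case (elim n)
      define q where "q = real n * sqrt (real n) / 2"
      have n: "sqrt (real n) > 0" "real n > 0" using elim(3) by auto
      have q: "q > 0" using n by (simp add: q_def)
      have w: "2 / sqrt (real n) + sqrt (real t) > 0" using n by (simp add: add_pos_nonneg)
      have X: "K * q \<le> X n" using elim(2) by (simp add: X_def K_def q_def)
      have "Z n \<le> real n + sqrt (real t) / 2 * real n * sqrt (real n)"
        unfolding Z_def by (rule z_number_le)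
      also have "\<dots> = (2 / sqrt (real n) + sqrt (real t)) * q"
        using n by (simp add: q_def field_simps)
      finally have Z: "Z n \<le> (2 / sqrt (real n) + sqrt (real t)) * q" .
      have Z0: "Z n > 0" unfolding Z_def using z_number_pos[of n "2 * t + 1"] elim(3) assms by simp
      have "d < K / (2 / sqrt (real n) + sqrt (real t))" by (rule elim(1))
      also have "\<dots> = K * q / ((2 / sqrt (real n) + sqrt (real t)) * q)" using q by simp
      also have "\<dots> \<le> X n / Z n"
      proof (rule frac_le)
        show "0 \<le> X n" by (simp add: X_def)
      qed (use X Z Z0 in auto)
      finally show ?case .
    qed
  qed
  have "ereal c \<le> liminf (\<lambda>n. ereal (X n / Z n))"
    unfolding le_Liminf_iff
  proof (intro allI impI)
    fix y assume y: "y < ereal c"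
    \<comment> \<open>An extended real below \<open>ereal c\<close> is either real, where
      \<open>ev\<close> applies, or minus infinity, where the claim is trivial.\<close>
    show "\<forall>\<^sub>F n in sequentially. y < ereal (X n / Z n)"
      using y ev by (cases y) auto
  qed
  then show ?thesis by (simp add: c_def X_def Z_def)
qed

end
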